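(* Let $m\ge 1$. (i) The two-graph associated with the graph $NO^{\pm}(2m,2)$ is isomorphic to the two-graph $\mathcal{X}^{\pm}_{2m}$. (ii) The two-graph associated with the graph $NO^{\mp}(2m+1,4)$ is isomorphic to the two-graph $\mathcal{X}^{\pm}_{4m}$. (iii) The strongly regular graphs $NO^{\pm}(4m,2)$ and $NO^{\mp}(2m+1,4)$ are switching equivalent. (The signs are read consistently: upper signs together, lower signs together.)
   Context: A quadratic form $\Theta$ on $\mathbb{F}_q^{n}$ ($q$ a power of $2$) has polar form $f(u,v)=\Theta(u+v)+\Theta(u)+\Theta(v)$, which is alternating. For $n=2m$, $\Theta$ is non-degenerate if $f$ is non-degenerate; it is then of type $+1$ (hyperbolic) if its Witt index is $m$ and of type $-1$ (elliptic) if its Witt index is $m-1$. $Q^{\pm}(2m-1,q)$ denotes the projective quadric $\{P(a)\in PG(2m-1,q): \Theta(a)=0\}$ of such a form of type $\pm1$. A line is tangent to a quadric if it meets it in exactly one point or is contained in it. $NO^{\pm}(2m,2)$: the graph whose vertices are the points of $PG(2m-1,2)$ not on a non-singular quadric $Q^{\pm}(2m-1,2)$, two vertices being adjacent iff they lie on a line tangent to the quadric. $NO^{\pm}(2m+1,q)$ ($q$ even): take a non-singular parabolic quadric $Q(2m,q)$ in $PG(2m,q)$ (zero set of a quadratic form on $\mathbb{F}_q^{2m+1}$ of maximal Witt index $m$); its polar form has a $1$-dimensional radical whose projective point $N$ is the nucleus. Vertices are the hyperplanes $H$ with $N\notin H$ such that $H\cap Q(2m,q)$ is a non-singular quadric of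 type $\pm1$ in $H$; two such hyperplanes $H_1,H_2$ are adjacent iff $H_1\cap H_2\cap Q(2m,q)$ is a degenerate (singular) quadric in $H_1\cap H_2$. A two-graph is a pair $(X,T)$ with $T$ a set of 3-subsets of $X$ such that every 4-subset of $X$ contains an even number of members of $T$. The two-graph associated with a graph $G$ on vertex set $X$ is $(X,T)$ where $T$ consists of the 3-subsets inducing an odd number of edges. Two graphs on the same vertex set are switching equivalent if one is obtained from the other by Seidel switching with respect to some vertex subset $Y$ (replacing edges between $Y$ and its complement by non-edges and vice versa). $\mathcal{X}^{\pm}_{2m}$: let $\Theta$ be a non-degenerate quadratic form of type $\pm1$ on $\mathbb{F}_2^{2m}$ with polar (symplectic) form $\langle\cdot,\cdot\rangle$; $\mathcal{X}^{\pm}_{2m}=(X,T)$ with $X=\{a\in\mathbb{F}_2^{2m}:\Theta(a)=1\}$ and $T$ the set of 3-subsets $\{a,b,c\}$ of $X$ (distinct elements) with $\langle a,b\rangle+\langle a,c\rangle+\langle b,c\rangle=0$. *)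

theory Defs
  imports Main "HOL-Library.Cardinality"
begin

text \<open>Vectors of F^n are modelled as functions nat => F vanishing from index n on.\<close>

type_synonym 'a vec = "nat \<Rightarrow> 'a"

definition vecs :: "nat \<Rightarrow> ('a::zero) vec set" where
  "vecs n = {x. \<forall>i\<ge>n. x i = 0}"

definition vzero :: "('a::zero) vec" where
  "vzero = (\<lambda>_. 0)"

definition vadd :: "('a::plus) vec \<Rightarrow> 'a vec \<Rightarrow> 'a vec" where
  "vadd x y = (\<lambda>i. x i + y i)"

definition smul :: "'a::times \<Rightarrow> 'a vec \<Rightarrow> 'a vec" where
  "smul c x = (\<lambda>i. c * x i)"

definition lincomb :: "nat \<Rightarrow> (nat \<Rightarrow> 'a::comm_semiring_1) \<Rightarrow> (nat \<Rightarrow> 'a vec) \<Rightarrow> 'a vec" where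
  "lincomb k c vs = (\<lambda>i. \<Sum>j<k. c j * vs j i)"

definition span_of :: "nat \<Rightarrow> (nat \<Rightarrow> ('a::comm_semiring_1) vec) \<Rightarrow> 'a vec set" where
  "span_of k vs = range (\<lambda>c. lincomb k c vs)"

definition lin_indep :: "nat \<Rightarrow> (nat \<Rightarrow> ('a::comm_semiring_1) vec) \<Rightarrow> bool" where
  "lin_indep k vs \<longleftrightarrow> (\<forall>c. lincomb k c vs = vzero \<longrightarrow> (\<forall>j<k. c j = 0))"

definition subspace_dim :: "nat \<Rightarrow> ('a::comm_semiring_1) vec set \<Rightarrow> nat \<Rightarrow> bool" where
  "subspace_dim n W k \<longleftrightarrow>
     (\<exists>vs. (\<forall>j<k. vs j \<in> vecs n) \<and> lin_indep k vs \<and> W = span_of k vs)"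

text \<open>Projective point P(a) (as the 1-dimensional subspace spanned by a).\<close>
definition pt :: "('a::comm_semiring_1) vec \<Rightarrow> 'a vec set" where
  "pt a = range (\<lambda>c. smul c a)"

text \<open>Projective line through P(a), P(b) (as the subspace spanned by a, b).\<close>
definition line :: "('a::comm_semiring_1) vec \<Rightarrow> 'a vec \<Rightarrow> 'a vec set" where
  "line a b = span_of 2 (\<lambda>j. if j = 0 then a else b)"

definition is_qform :: "nat \<Rightarrow> (('a::comm_semiring_1) vec \<Rightarrow> 'a) \<Rightarrow> bool" where
  "is_qform n \<Theta> \<longleftrightarrow>
     (\<exists>c. \<forall>x\<in>vecs n. \<Theta> x = (\<Sum>i<n. \<Sum>j\<in>{i..<n}. c i j * x i * x j))"

definition polar :: "(('a::comm_semiring_1) vec \<Rightarrow> 'a) \<Rightarrow> 'a vec \<Rightarrow> 'a vec \<Rightarrow> 'a" where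
  "polar \<Theta> u v = \<Theta> (vadd u v) + \<Theta> u + \<Theta> v"

definition rad :: "(('a::comm_semiring_1) vec \<Rightarrow> 'a) \<Rightarrow> 'a vec set \<Rightarrow> 'a vec set" where
  "rad \<Theta> W = {u\<in>W. \<forall>v\<in>W. polar \<Theta> u v = 0}"

definition nondeg :: "(('a::comm_semiring_1) vec \<Rightarrow> 'a) \<Rightarrow> 'a vec set \<Rightarrow> bool" where
  "nondeg \<Theta> W \<longleftrightarrow> rad \<Theta> W = {vzero}"

definition singular :: "(('a::comm_semiring_1) vec \<Rightarrow> 'a) \<Rightarrow> 'a vec set \<Rightarrow> bool" where
  "singular \<Theta> W \<longleftrightarrow> (\<exists>u\<in>rad \<Theta> W. u \<noteq> vzero \<and> \<Theta> u = 0)"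

definition tot_sing :: "(('a::comm_semiring_1) vec \<Rightarrow> 'a) \<Rightarrow> 'a vec set \<Rightarrow> nat \<Rightarrow> bool" where
  "tot_sing \<Theta> W k \<longleftrightarrow>
     (\<exists>vs. (\<forall>j<k. vs j \<in> W) \<and> lin_indep k vs \<and> (\<forall>u\<in>span_of k vs. \<Theta> u = 0))"

definition witt_index :: "(('a::comm_semiring_1) vec \<Rightarrow> 'a) \<Rightarrow> 'a vec set \<Rightarrow> nat" where
  "witt_index \<Theta> W = (GREATEST k. tot_sing \<Theta> W k)"

text \<open>Sign convention: s = True means type +1, s = False means type -1.
  form_type n Theta s: Theta is a non-degenerate quadratic form of type s on F^n (n = 2m).\<close>
definition form_type :: "nat \<Rightarrow> (('a::comm_semiring_1) vec \<Rightarrow> 'a) \<Rightarrow> bool \<Rightarrow> bool" where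
  "form_type n \<Theta> s \<longleftrightarrow> is_qform n \<Theta> \<and> nondeg \<Theta> (vecs n) \<and>
     witt_index \<Theta> (vecs n) = (if s then n div 2 else n div 2 - 1)"

definition parabolic :: "nat \<Rightarrow> (('a::comm_semiring_1) vec \<Rightarrow> 'a) \<Rightarrow> bool" where
  "parabolic m \<Theta> \<longleftrightarrow> is_qform (2*m+1) \<Theta> \<and> \<not> singular \<Theta> (vecs (2*m+1)) \<and>
     witt_index \<Theta> (vecs (2*m+1)) = m"

definition NO_even_V :: "nat \<Rightarrow> (('a::comm_semiring_1) vec \<Rightarrow> 'a) \<Rightarrow> 'a vec set set" where
  "NO_even_V n \<Theta> = {pt a | a. a \<in> vecs n \<and> a \<noteq> vzero \<and> \<Theta> a \<noteq> 0}"

definition tangent :: "(('a::comm_semiring_1) vec \<Rightarrow> 'a) \<Rightarrow> 'a vec set \<Rightarrow> bool" where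
  "tangent \<Theta> L \<longleftrightarrow>
     card {P. \<exists>c\<in>L. c \<noteq> vzero \<and> \<Theta> c = 0 \<and> P = pt c} = 1 \<or> (\<forall>c\<in>L. \<Theta> c = 0)"

definition NO_even_adj :: "(('a::comm_semiring_1) vec \<Rightarrow> 'a) \<Rightarrow> 'a vec set \<Rightarrow> 'a vec set \<Rightarrow> bool" where
  "NO_even_adj \<Theta> P P' \<longleftrightarrow> P \<noteq> P' \<and> (\<exists>a b. P = pt a \<and> P' = pt b \<and> tangent \<Theta> (line a b))"

text \<open>NO(2m+1,q): vertices are hyperplanes (2m-dimensional subspaces of F^(2m+1))
  not containing the nucleus, meeting the quadric in a non-singular quadric of type s.\<close>
definition NO_odd_V :: "nat \<Rightarrow> (('a::comm_semiring_1) vec \<Rightarrow> 'a) \<Rightarrow> bool \<Rightarrow> 'a vec set set" where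
  "NO_odd_V m \<Theta> s = {H. subspace_dim (2*m+1) H (2*m) \<and> \<not> rad \<Theta> (vecs (2*m+1)) \<subseteq> H \<and>
      nondeg \<Theta> H \<and> witt_index \<Theta> H = (if s then m else m - 1)}"

definition NO_odd_adj :: "(('a::comm_semiring_1) vec \<Rightarrow> 'a) \<Rightarrow> 'a vec set \<Rightarrow> 'a vec set \<Rightarrow> bool" where
  "NO_odd_adj \<Theta> H1 H2 \<longleftrightarrow> H1 \<noteq> H2 \<and> singular \<Theta> (H1 \<inter> H2)"

definition two_graph_of :: "'v set \<Rightarrow> ('v \<Rightarrow> 'v \<Rightarrow> bool) \<Rightarrow> 'v set \<times> 'v set set" where
  "two_graph_of V E = (V, {t. t \<subseteq> V \<and> card t = 3 \<and>
      odd (card {e. \<exists>x y. e = {x, y} \<and> x \<in> t \<and> y \<in> t \<and> x \<noteq> y \<and> E x y})})"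

definition tg_iso :: "'v set \<times> 'v set set \<Rightarrow> 'w set \<times> 'w set set \<Rightarrow> bool" where
  "tg_iso G H \<longleftrightarrow> (\<exists>f. bij_betw f (fst G) (fst H) \<and>
      (\<forall>t. t \<subseteq> fst G \<longrightarrow> (t \<in> snd G \<longleftrightarrow> f ` t \<in> snd H)))"

definition X_tg :: "nat \<Rightarrow> (('a::comm_semiring_1) vec \<Rightarrow> 'a) \<Rightarrow> 'a vec set \<times> 'a vec set set" where
  "X_tg n \<Phi> = ({a\<in>vecs n. \<Phi> a = 1},
     {t. \<exists>a b c. t = {a, b, c} \<and> a \<in> vecs n \<and> b \<in> vecs n \<and> c \<in> vecs n \<and>
        \<Phi> a = 1 \<and> \<Phi> b = 1 \<and> \<Phi> c = 1 \<and> a \<noteq> b \<and> a \<noteq> c \<and> b \<noteq> c \<and>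
        polar \<Phi> a b + polar \<Phi> a c + polar \<Phi> b c = 0})"

text \<open>Graphs (V1,E1), (V2,E2) on different vertex sets are switching equivalent
  (after identifying the vertex sets via a bijection f): E2 is obtained from the
  image of E1 by Seidel switching with respect to f ` Y.\<close>
definition switching_equiv :: "'v set \<Rightarrow> ('v \<Rightarrow> 'v \<Rightarrow> bool) \<Rightarrow> 'w set \<Rightarrow> ('w \<Rightarrow> 'w \<Rightarrow> bool) \<Rightarrow> bool" where
  "switching_equiv V1 E1 V2 E2 \<longleftrightarrow> (\<exists>f Y. bij_betw f V1 V2 \<and> Y \<subseteq> V1 \<and>
      (\<forall>x\<in>V1. \<forall>y\<in>V1. x \<noteq> y \<longrightarrow> (E2 (f x) (f y) \<longleftrightarrow> (E1 x y \<longleftrightarrow> (x \<in> Y \<longleftrightarrow> y \<in> Y)))))"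

end

theory Submission
  imports Defs "HOL-Library.Function_Algebras" "HOL-Library.FuncSet"
begin

text \<open>
  Compose a quadratic form over a field of order 2 or 4 with the sign character \<open>\<chi>\<close> of the
  absolute trace. The resulting \<open>\<plusminus>1\<close>-valued function \<open>q\<close> determines an \<open>\<F>\<^sub>2\<close>-quadratic form,
  and its Gauss sum \<open>G = \<Sum> q\<close> detects the type: if \<open>k\<close> is the Witt index on a non-degenerate
  \<open>n\<close>-dimensional space over a field of order \<open>r\<close>, then \<open>(r - 1) G = r\<^sup>k\<^sup>+\<^sup>1 - r\<^sup>n\<^sup>-\<^sup>k\<close>, so for
  \<open>n = 2m\<close> one has \<open>G = r\<^sup>m\<close> in type \<open>+1\<close> and \<open>G = -r\<^sup>m\<close> in type \<open>-1\<close>. Splitting off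
  hyperbolic planes shows that two such sign forms with equal cardinality and equal Gauss sum
  are isometric.

  Over the field of order 2, tangency of the line through two non-singular points \<open>a, b\<close> means
  \<open>\<langle>a, b\<rangle> = 0\<close>, which gives (i). For a parabolic form \<open>\<Theta>\<close> over the field of order 4 with nucleus
  \<open>N\<close>, \<open>\<Theta>(N) = 1\<close>, fix a hyperplane \<open>H\<^sub>0\<close> of type \<open>s\<close> missing \<open>N\<close>. The hyperplanes missing \<open>N\<close>
  are \<open>H\<^sub>a = {x + \<langle>x, a\<rangle> N : x \<in> H\<^sub>0}\<close> for \<open>a \<in> H\<^sub>0\<close>, with Gauss sum \<open>\<chi>(\<Theta>(a))\<close> times that of \<open>H\<^sub>0\<close>;
  so the vertices of type \<open>-s\<close> are the \<open>H\<^sub>a\<close> with \<open>Tr \<Theta>(a) = 1\<close>. Finally \<open>H\<^sub>a\<close> and \<open>H\<^sub>b\<close> are adjacent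
  iff \<open>\<Theta>(a) + \<Theta>(b) + Tr \<langle>a, b\<rangle> = 0\<close>, which is a switching, with respect to a fibre of \<open>\<Theta>\<close>,
  of the graph \<open>Tr \<langle>a, b\<rangle> = 0\<close>. This is (iii), and (ii) follows.
\<close>

section \<open>Sign-valued quadratic forms\<close>

text \<open>The polar form in multiplicative notation: for values 1 and -1, products replace sums
  and every value is its own inverse.\<close>

definition sign_polar :: "('v::ab_group_add \<Rightarrow> int) \<Rightarrow> 'v \<Rightarrow> 'v \<Rightarrow> int" where
  "sign_polar q x y = q (x + y) * q x * q y"

text \<open>A non-degenerate quadratic space over the field of order 2, written without scalars:
  \<open>dbl\<close> makes \<open>V\<close> an elementary abelian 2-group inside an ambient group.
  In this form spaces over fields of order 2 and 4 become directly comparable.\<close>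

locale signed_form =
  fixes V :: "'v::ab_group_add set" and q :: "'v \<Rightarrow> int"
  assumes fin: "finite V" and zero: "0 \<in> V"
    and add: "x \<in> V \<Longrightarrow> y \<in> V \<Longrightarrow> x + y \<in> V"
    and dbl: "x \<in> V \<Longrightarrow> x + x = 0"
    and sgn: "x \<in> V \<Longrightarrow> q x = 1 \<or> q x = -1"
    and pol_add: "x \<in> V \<Longrightarrow> y \<in> V \<Longrightarrow> z \<in> V \<Longrightarrow> sign_polar q (x + y) z = sign_polar q x z * sign_polar q y z"
    and pol_nondeg: "x \<in> V \<Longrightarrow> (\<And>y. y \<in> V \<Longrightarrow> sign_polar q x y = 1) \<Longrightarrow> x = 0"
begin

lemma q_zero: "q 0 = 1"
  using pol_add[OF zero zero zero] sgn[OF zero] by (auto simp: sign_polar_def)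

lemma pol_sym: "sign_polar q x y = sign_polar q y x"
  by (simp add: sign_polar_def add.commute mult_ac)

lemma pol_sgn: "x \<in> V \<Longrightarrow> y \<in> V \<Longrightarrow> sign_polar q x y = 1 \<or> sign_polar q x y = -1"
  using sgn[of x] sgn[of y] sgn[OF add, of x y] by (auto simp: sign_polar_def)

lemma pol_add_right: "x \<in> V \<Longrightarrow> y \<in> V \<Longrightarrow> z \<in> V \<Longrightarrow> sign_polar q z (x + y) = sign_polar q z x * sign_polar q z y"
  using pol_add by (simp add: pol_sym)

lemma pol_self: "x \<in> V \<Longrightarrow> sign_polar q x x = 1"
  using sgn[of x] by (auto simp: sign_polar_def dbl q_zero)

lemma pol_zero: "x \<in> V \<Longrightarrow> sign_polar q x 0 = 1" "x \<in> V \<Longrightarrow> sign_polar q 0 x = 1"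
  using sgn[of x] by (auto simp: sign_polar_def q_zero)

lemma q_add: "x \<in> V \<Longrightarrow> y \<in> V \<Longrightarrow> q (x + y) = q x * q y * sign_polar q x y"
  using sgn[of x] sgn[of y] by (auto simp: sign_polar_def)

lemma add_cancel: "x \<in> V \<Longrightarrow> x + (x + y) = y" "x \<in> V \<Longrightarrow> y + x + x = y"
  using dbl[of x] by (metis add.assoc add_0, metis add.assoc add.right_neutral)

lemma eq_add_iff: "x \<in> V \<Longrightarrow> y \<in> V \<Longrightarrow> x + y = 0 \<longleftrightarrow> x = y"
  by (metis add_cancel(2) dbl add_0)

lemma bij_translate:
  assumes "U \<subseteq> V" "\<And>x y. x \<in> U \<Longrightarrow> y \<in> U \<Longrightarrow> x + y \<in> U" "u \<in> U"
  shows "bij_betw (\<lambda>x. x + u) U U"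
  using assms add_cancel(2)
  by (intro bij_betw_byWitness[where f' = "\<lambda>x. x + u"]) (auto simp: subset_iff)

text \<open>Orthogonality of characters: \<open>sign_polar q x\<close> is a character of
  \<open>U\<close>, and translation by some \<open>w\<close> with value -1 negates the sum.\<close>

lemma sum_pol:
  assumes U: "U \<subseteq> V" "\<And>x y. x \<in> U \<Longrightarrow> y \<in> U \<Longrightarrow> x + y \<in> U" and x: "x \<in> V"
  shows "(\<Sum>u\<in>U. sign_polar q x u) = (if \<forall>u\<in>U. sign_polar q x u = 1 then int (card U) else 0)"
proof (cases "\<forall>u\<in>U. sign_polar q x u = 1")
  case False
  then obtain w where w: "w \<in> U" "sign_polar q x w = -1"
    using pol_sgn[OF x] U by blast
  have "(\<Sum>u\<in>U. sign_polar q x u) = (\<Sum>u\<in>U. sign_polar q x (u + w))"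
    by (rule sum.reindex_bij_betw[symmetric]) (rule bij_translate[OF U w(1)])
  also have "\<dots> = (\<Sum>u\<in>U. - sign_polar q x u)"
    using U w x by (intro sum.cong) (auto simp: pol_add_right subset_iff)
  finally have "(\<Sum>u\<in>U. sign_polar q x u) = 0"
    by (simp add: sum_negf)
  then show ?thesis
    using False by (simp only: if_False)
qed auto

abbreviation perp :: "'v set \<Rightarrow> 'v set" where
  "perp U \<equiv> {x \<in> V. \<forall>u\<in>U. sign_polar q x u = 1}"

text \<open>Double counting of the sum of \<open>sign_polar q x u\<close> over \<open>V\<close> and
  \<open>U\<close>. By \<open>sum_pol\<close>, summing over \<open>u\<close> first leaves the
  vectors of \<open>perp U\<close>; summing over \<open>x\<close> first leaves only
  \<open>u = 0\<close>, by non-degeneracy.\<close>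

lemma card_perp:
  assumes U: "U \<subseteq> V" "0 \<in> U" "\<And>x y. x \<in> U \<Longrightarrow> y \<in> U \<Longrightarrow> x + y \<in> U"
  shows "int (card U) * int (card (perp U)) = int (card V)"
proof -
  have fU: "finite U"
    using U(1) fin finite_subset by blast
  have "(\<Sum>x\<in>V. \<Sum>u\<in>U. sign_polar q x u) = (\<Sum>x\<in>V. if \<forall>u\<in>U. sign_polar q x u = 1 then int (card U) else 0)"
    using U by (intro sum.cong refl sum_pol) auto
  also have "\<dots> = int (card U) * int (card (perp U))"
    using fin by (simp add: sum.If_cases Int_def)
  finally have 1: "(\<Sum>x\<in>V. \<Sum>u\<in>U. sign_polar q x u) = int (card U) * int (card (perp U))" .
  have "(\<Sum>x\<in>V. \<Sum>u\<in>U. sign_polar q x u) = (\<Sum>u\<in>U. \<Sum>x\<in>V. sign_polar q u x)"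
    by (subst sum.swap) (simp add: pol_sym)
  also have "\<dots> = (\<Sum>u\<in>U. if u = 0 then int (card V) else 0)"
  proof (intro sum.cong refl)
    fix u assume u: "u \<in> U"
    then have "(\<forall>x\<in>V. sign_polar q u x = 1) \<longleftrightarrow> u = 0"
      using U pol_nondeg pol_zero by blast
    then show "(\<Sum>x\<in>V. sign_polar q u x) = (if u = 0 then int (card V) else 0)"
      using sum_pol[of V u] add u U by auto
  qed
  also have "\<dots> = int (card V)"
    using U fU by (simp add: sum.delta)
  finally show ?thesis
    using 1 by simp
qed

text \<open>Averaging over translates by \<open>U\<close>:
  \<open>q (x + u) = q x * sign_polar q x u\<close> because \<open>q u = 1\<close>, so the
  contributions of all \<open>x\<close> outside \<open>perp U\<close> cancel.\<close>

lemma sum_eq_sum_perp: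
  assumes U: "U \<subseteq> V" "0 \<in> U" "\<And>x y. x \<in> U \<Longrightarrow> y \<in> U \<Longrightarrow> x + y \<in> U"
    and sing: "\<And>u. u \<in> U \<Longrightarrow> q u = 1"
  shows "sum q V = sum q (perp U)"
proof -
  have fU: "finite U"
    using U(1) fin finite_subset by blast
  have "(\<Sum>u\<in>U. \<Sum>x\<in>V. q (x + u)) = (\<Sum>u\<in>U. sum q V)"
    using U add by (intro sum.cong refl sum.reindex_bij_betw bij_translate) auto
  then have "int (card U) * sum q V = (\<Sum>x\<in>V. \<Sum>u\<in>U. q (x + u))"
    by (subst sum.swap) simp
  also have "\<dots> = (\<Sum>x\<in>V. q x * (\<Sum>u\<in>U. sign_polar q x u))"
    using U sing by (intro sum.cong) (auto simp: sum_distrib_left q_add subset_iff intro!: sum.cong)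
  also have "\<dots> = (\<Sum>x\<in>V. if \<forall>u\<in>U. sign_polar q x u = 1 then q x * int (card U) else 0)"
    using U by (intro sum.cong refl) (simp add: sum_pol)
  also have "\<dots> = int (card U) * sum q (perp U)"
    using fin by (simp add: sum.If_cases Int_def sum_distrib_left mult.commute)
  finally show ?thesis
    using U fU by auto
qed

text \<open>Replacing \<open>y\<close> by \<open>y + x\<close> in the double sum turns
  \<open>q x * q (y + x)\<close> into \<open>q y * sign_polar q y x\<close>; the sum over
  \<open>x\<close> then kills every \<open>y\<close> except 0.\<close>

lemma gauss_sum_square: "sum q V * sum q V = int (card V)"
proof -
  have "sum q V * sum q V = (\<Sum>x\<in>V. q x * (\<Sum>y\<in>V. q (y + x)))"
  proof -
    have "(\<Sum>y\<in>V. q (y + x)) = sum q V" if "x \<in> V" for x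
      using that add by (intro sum.reindex_bij_betw bij_translate) auto
    then show ?thesis
      by (simp add: sum_distrib_right)
  qed
  also have "\<dots> = (\<Sum>x\<in>V. \<Sum>y\<in>V. q y * sign_polar q y x)"
    unfolding sum_distrib_left
    by (intro sum.cong refl) (use sgn q_add in force)
  also have "\<dots> = (\<Sum>y\<in>V. \<Sum>x\<in>V. q y * sign_polar q y x)"
    by (rule sum.swap)
  also have "\<dots> = (\<Sum>y\<in>V. if y = 0 then int (card V) else 0)"
  proof (intro sum.cong refl)
    fix y assume y: "y \<in> V"
    then have "(\<forall>x\<in>V. sign_polar q y x = 1) \<longleftrightarrow> y = 0"
      using pol_nondeg pol_zero by blast
    then show "(\<Sum>x\<in>V. q y * sign_polar q y x) = (if y = 0 then int (card V) else 0)"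
      using sum_pol[of V y] add y by (auto simp: q_zero simp flip: sum_distrib_left)
  qed
  also have "\<dots> = int (card V)"
    using zero fin by simp
  finally show ?thesis .
qed

lemma card_singular: "2 * int (card {x \<in> V. q x = 1}) = int (card V) + sum q V"
proof -
  have "int (card V) + sum q V = (\<Sum>x\<in>V. 1 + q x)"
    by (simp add: sum.distrib)
  also have "\<dots> = (\<Sum>x\<in>V. if q x = 1 then 2 else 0)"
    by (intro sum.cong refl) (use sgn in fastforce)
  also have "\<dots> = 2 * int (card {x \<in> V. q x = 1})"
    using fin by (simp add: sum.If_cases Int_def)
  finally show ?thesis by simp
qed

text \<open>If a partner \<open>g\<close> of \<open>e\<close> has \<open>q g = -1\<close>, then
  \<open>e + g\<close> is still a partner and \<open>q (e + g) = 1 * -1 * -1\<close>.\<close>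

lemma hyperbolic_pair:
  assumes e: "e \<in> V" "e \<noteq> 0" "q e = 1"
  obtains f where "f \<in> V" "q f = 1" "sign_polar q e f = -1"
proof -
  obtain g where g: "g \<in> V" "sign_polar q e g = -1"
    using e pol_nondeg pol_sgn by metis
  show thesis
  proof (cases "q g = 1")
    case True
    then show ?thesis using that g by blast
  next
    case False
    then have "q g = -1" using g sgn by blast
    then show ?thesis
      using that[of "e + g"] g e by (simp add: q_add add pol_add_right pol_self)
  qed
qed

end

section \<open>Splitting off a hyperbolic plane\<close>

text \<open>Coordinates for the orthogonal decomposition into the plane on \<open>e\<close>,
  \<open>f\<close> and its complement; the Booleans are coefficients in the field of order
  2.\<close>

fun hyp_glue :: "'v::ab_group_add \<Rightarrow> 'v \<Rightarrow> bool \<times> bool \<times> 'v \<Rightarrow> 'v" where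
  "hyp_glue e f (\<alpha>, \<beta>, x) = (if \<alpha> then e else 0) + (if \<beta> then f else 0) + x"

locale hyperbolic_plane = signed_form +
  fixes e f
  assumes e: "e \<in> V" "q e = 1" and f: "f \<in> V" "q f = 1" and ef: "sign_polar q e f = -1"
begin

definition V' where "V' = {x \<in> V. sign_polar q x e = 1 \<and> sign_polar q x f = 1}"

lemma V'_sub: "x \<in> V' \<Longrightarrow> x \<in> V"
  by (simp add: V'_def)

lemma fe: "sign_polar q f e = -1"
  using ef pol_sym by metis

lemma V'_pol:
  "x \<in> V' \<Longrightarrow> sign_polar q x e = 1" "x \<in> V' \<Longrightarrow> sign_polar q x f = 1"
  "x \<in> V' \<Longrightarrow> sign_polar q e x = 1" "x \<in> V' \<Longrightarrow> sign_polar q f x = 1"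
  by (auto simp: V'_def pol_sym[of e x] pol_sym[of f x])

lemma glue_mem: "x \<in> V' \<Longrightarrow> hyp_glue e f (\<alpha>, \<beta>, x) \<in> V"
  using e f by (auto simp: add zero V'_def)

lemma pol_glue:
  assumes "x \<in> V'" "y \<in> V'"
  shows "sign_polar q (hyp_glue e f (\<alpha>, \<beta>, x)) (hyp_glue e f (\<gamma>, \<delta>, y)) =
    (if \<alpha> \<and> \<delta> then -1 else 1) * (if \<beta> \<and> \<gamma> then -1 else 1) * sign_polar q x y"
  using assms e f ef fe
  by (cases \<alpha>; cases \<beta>; cases \<gamma>; cases \<delta>)
    (simp_all add: V'_sub V'_pol pol_add pol_add_right pol_self pol_zero add zero)

lemma q_glue:
  assumes "x \<in> V'"
  shows "q (hyp_glue e f (\<alpha>, \<beta>, x)) = (if \<alpha> \<and> \<beta> then -1 else 1) * q x"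
  using assms e f ef
  by (cases \<alpha>; cases \<beta>)
    (simp_all add: V'_sub V'_pol q_add pol_add add)

text \<open>The coefficient of \<open>e\<close> is read off by pairing with \<open>f\<close>, and
  that of \<open>f\<close> by pairing with \<open>e\<close>. Since addition is its own inverse,
  gluing the plane part onto \<open>x\<close> once more leaves the component in
  \<open>V'\<close>.\<close>

lemma bij_glue: "bij_betw (hyp_glue e f) (UNIV \<times> UNIV \<times> V') V"
proof (rule bij_betw_byWitness[where f' = "\<lambda>x. (sign_polar q x f = -1, sign_polar q x e = -1,
    hyp_glue e f (sign_polar q x f = -1, sign_polar q x e = -1, x))"])
  show "hyp_glue e f ` (UNIV \<times> UNIV \<times> V') \<subseteq> V"
    using glue_mem by blast
  show "\<forall>a\<in>V. hyp_glue e f (sign_polar q a f = -1, sign_polar q a e = -1,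
    hyp_glue e f (sign_polar q a f = -1, sign_polar q a e = -1, a)) = a"
    using e f by (auto simp: add_cancel dbl add.left_commute add.assoc)
  show "\<forall>a\<in>UNIV \<times> UNIV \<times> V'. (sign_polar q (hyp_glue e f a) f = -1, sign_polar q (hyp_glue e f a) e = -1,
    hyp_glue e f (sign_polar q (hyp_glue e f a) f = -1, sign_polar q (hyp_glue e f a) e = -1, hyp_glue e f a)) = a"
    using e f ef fe
    by (auto simp: V'_sub V'_pol pol_add pol_self pol_zero add zero)
      (simp_all add: add_cancel dbl add.left_commute add.assoc)
  show "(\<lambda>x. (sign_polar q x f = -1, sign_polar q x e = -1,
    hyp_glue e f (sign_polar q x f = -1, sign_polar q x e = -1, x))) ` V \<subseteq> UNIV \<times> UNIV \<times> V'"
    using e f ef fe pol_sgn[OF _ e(1)] pol_sgn[OF _ f(1)]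
    by (auto simp: V'_def pol_add pol_self pol_zero add zero) blast+
qed

text \<open>Non-degeneracy descends because a vector of \<open>V'\<close> is orthogonal to
  \<open>e\<close> and \<open>f\<close> by definition, so orthogonality to \<open>V'\<close> is
  already orthogonality to \<open>V\<close>.\<close>

lemma signed_form_V': "signed_form V' q"
proof
  show "finite V'" by (simp add: V'_def fin)
  show "0 \<in> V'" using e f by (simp add: V'_def zero pol_zero)
  show "x + y \<in> V'" if "x \<in> V'" "y \<in> V'" for x y
    using that e f by (auto simp: V'_def add pol_add)
  show "x = 0" if x: "x \<in> V'" and perp: "\<And>y. y \<in> V' \<Longrightarrow> sign_polar q x y = 1" for x
  proof (rule pol_nondeg)
    show "x \<in> V" using x V'_sub by simp
    fix y assume "y \<in> V"
    then obtain \<alpha> \<beta> z where y: "y = hyp_glue e f (\<alpha>, \<beta>, z)" "z \<in> V'"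
      using bij_glue unfolding bij_betw_def by blast
    have "sign_polar q (hyp_glue e f (False, False, x)) y = 1"
      unfolding y(1) pol_glue[OF x y(2)] using perp[OF y(2)] by simp
    then show "sign_polar q x y = 1" by simp
  qed
qed (use V'_sub dbl sgn pol_add in auto)

lemma card_V: "card V = 4 * card V'"
  using bij_betw_same_card[OF bij_glue] by (simp add: card_cartesian_product)

lemma sum_V: "sum q V = 2 * sum q V'"
proof -
  have "sum q V = (\<Sum>t\<in>UNIV \<times> UNIV \<times> V'. q (hyp_glue e f t))"
    by (rule sum.reindex_bij_betw[symmetric, OF bij_glue])
  also have "\<dots> = (\<Sum>\<alpha>\<in>UNIV. \<Sum>\<beta>\<in>UNIV. \<Sum>x\<in>V'. q (hyp_glue e f (\<alpha>, \<beta>, x)))"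
    unfolding sum.cartesian_product by (rule sum.cong) auto
  also have "\<dots> = (\<Sum>\<alpha>\<in>UNIV. \<Sum>\<beta>\<in>UNIV. \<Sum>x\<in>V'. (if \<alpha> \<and> \<beta> then -1 else 1) * q x)"
    by (intro sum.cong refl q_glue)
  also have "\<dots> = 2 * sum q V'"
    by (simp add: UNIV_bool sum_negf)
  finally show ?thesis .
qed

end

section \<open>Classification by cardinality and Gauss sum\<close>

text \<open>Induction on the cardinality. Removing a hyperbolic plane on both sides divides the
  cardinalities by 4 and the Gauss sums by 2, so the hypotheses persist; the process ends when no
  non-zero vector has sign 1.\<close>

theorem signed_form_isometry:
  fixes V1 :: "'v::ab_group_add set" and V2 :: "'w::ab_group_add set"
  assumes "signed_form V1 q1" "signed_form V2 q2"
    and "card V1 = card V2" "sum q1 V1 = sum q2 V2"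
  shows "\<exists>f. bij_betw f V1 V2 \<and> (\<forall>x\<in>V1. q2 (f x) = q1 x) \<and>
    (\<forall>x\<in>V1. \<forall>y\<in>V1. sign_polar q2 (f x) (f y) = sign_polar q1 x y)"
  using assms
proof (induction "card V1" arbitrary: V1 V2 rule: less_induct)
  case less
  interpret A: signed_form V1 q1 by fact
  interpret B: signed_form V2 q2 by fact
  \<comment> \<open>Since 0 is counted on both sides, a non-zero vector of sign 1 exists in both
    spaces or in neither.\<close>
  have cs: "card {x \<in> V1. q1 x = 1} = card {x \<in> V2. q2 x = 1}"
    using A.card_singular B.card_singular less.prems by simp
  show ?case
  proof (cases "\<exists>e\<in>V1. e \<noteq> 0 \<and> q1 e = 1")
    case False
    \<comment> \<open>Then \<open>q1\<close> and \<open>q2\<close> are \<open>-1\<close> off the origin, so every bijection fixing the origin works.\<close>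
    then have "{x \<in> V1. q1 x = 1} = {0}"
      using A.zero A.q_zero by auto
    then have "card {x \<in> V2. q2 x = 1} = 1" using cs by simp
    then obtain w where w: "{x \<in> V2. q2 x = 1} = {w}"
      using card_1_singletonE by blast
    have "0 \<in> {x \<in> V2. q2 x = 1}"
      using B.zero B.q_zero by simp
    then have B1: "{x \<in> V2. q2 x = 1} = {0}"
      unfolding w by simp
    have "card (V1 - {0}) = card (V2 - {0})"
      using less.prems A.zero B.zero by simp
    then obtain g where g: "bij_betw g (V1 - {0}) (V2 - {0})"
      using A.fin B.fin finite_same_card_bij by blast
    define f where "f = g(0 := 0)"
    have f0: "bij_betw f (V1 - {0}) (V2 - {0})"
      using g by (subst bij_betw_cong[where g = g]) (auto simp: f_def)
    have f: "bij_betw f V1 V2"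
      using notIn_Un_bij_betw[of 0 "V1 - {0}" f "V2 - {0}"] f0 A.zero B.zero
      by (simp add: f_def insert_absorb)
    have fV: "f x \<in> V2" if "x \<in> V1" for x
      using f that bij_betwE by blast
    have f_inj: "f x = f y \<longleftrightarrow> x = y" if "x \<in> V1" "y \<in> V1" for x y
      using f that by (auto simp: bij_betw_def inj_on_def)
    have f00: "f 0 = 0" by (simp add: f_def)
    have fx0: "f x = 0 \<longleftrightarrow> x = 0" if "x \<in> V1" for x
      using f_inj[OF that A.zero] f00 by simp
    have q1: "q1 x = (if x = 0 then 1 else -1)" if "x \<in> V1" for x
      using False A.q_zero A.sgn that by auto
    have q2: "q2 x = (if x = 0 then 1 else -1)" if "x \<in> V2" for x
      using B1 B.q_zero B.sgn that by auto
    have "q2 (f x) = q1 x" if "x \<in> V1" for x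
      using that by (simp add: q1 q2 fV fx0)
    \<comment> \<open>The polar sign depends only on which of \<open>x\<close>, \<open>y\<close>,
      \<open>x + y\<close> vanish, and \<open>x + y = 0\<close> means \<open>x = y\<close>;
      injectivity together with \<open>f 0 = 0\<close> is enough.\<close>
    moreover have "sign_polar q2 (f x) (f y) = sign_polar q1 x y" if "x \<in> V1" "y \<in> V1" for x y
      using that
      by (simp add: sign_polar_def q1 q2 fV fx0 A.add B.add A.eq_add_iff B.eq_add_iff f_inj f00)
    ultimately show ?thesis using f by blast
  next
    case True
    then obtain e1 where e1: "e1 \<in> V1" "e1 \<noteq> 0" "q1 e1 = 1" by blast
    have "\<exists>e\<in>V2. e \<noteq> 0 \<and> q2 e = 1"
    proof (rule ccontr)
      assume "\<not> ?thesis"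
      then have "{x \<in> V2. q2 x = 1} \<subseteq> {0}" by auto
      then have "card {x \<in> V2. q2 x = 1} \<le> card {0::'w}"
        by (rule card_mono[rotated]) simp
      moreover have "card {0, e1} \<le> card {x \<in> V1. q1 x = 1}"
        using A.fin A.zero A.q_zero e1 by (intro card_mono) auto
      ultimately show False using cs e1(2) by simp
    qed
    then obtain e2 where e2: "e2 \<in> V2" "e2 \<noteq> 0" "q2 e2 = 1" by blast
    obtain f1 where f1: "f1 \<in> V1" "q1 f1 = 1" "sign_polar q1 e1 f1 = -1"
      using A.hyperbolic_pair[OF e1] .
    obtain f2 where f2: "f2 \<in> V2" "q2 f2 = 1" "sign_polar q2 e2 f2 = -1"
      using B.hyperbolic_pair[OF e2] .
    interpret A: hyperbolic_plane V1 q1 e1 f1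
      by unfold_locales (use e1 f1 in auto)
    interpret B: hyperbolic_plane V2 q2 e2 f2
      by unfold_locales (use e2 f2 in auto)
    have "card V1 > 0" using A.fin A.zero by (auto simp: card_gt_0_iff)
    then have "card A.V' < card V1" using A.card_V by simp
    moreover have "card A.V' = card B.V'"
      using A.card_V B.card_V less.prems by simp
    moreover have "sum q1 A.V' = sum q2 B.V'"
      using A.sum_V B.sum_V less.prems by simp
    ultimately obtain g where g: "bij_betw g A.V' B.V'" "\<And>x. x \<in> A.V' \<Longrightarrow> q2 (g x) = q1 x"
      "\<And>x y. x \<in> A.V' \<Longrightarrow> y \<in> A.V' \<Longrightarrow> sign_polar q2 (g x) (g y) = sign_polar q1 x y"
      using less.hyps[OF _ A.signed_form_V' B.signed_form_V'] by blast
    have gV: "g x \<in> B.V'" if "x \<in> A.V'" for x using g(1) that bij_betwE by blast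
    define k where "k = the_inv_into (UNIV \<times> UNIV \<times> A.V') (hyp_glue e1 f1)"
    have k: "bij_betw k V1 (UNIV \<times> UNIV \<times> A.V')"
      unfolding k_def by (rule bij_betw_the_inv_into[OF A.bij_glue])
    have gk: "hyp_glue e1 f1 (k x) = x" if "x \<in> V1" for x
      using f_the_inv_into_f_bij_betw[OF A.bij_glue] that unfolding k_def by blast
    \<comment> \<open>The plane coordinates are copied, and the inductive isometry \<open>g\<close>
      acts on the complement.\<close>
    define f where "f x = (case k x of (\<alpha>, \<beta>, y) \<Rightarrow> hyp_glue e2 f2 (\<alpha>, \<beta>, g y))" for x
    have kx: "\<exists>\<alpha> \<beta> y. k x = (\<alpha>, \<beta>, y) \<and> y \<in> A.V' \<and> x = hyp_glue e1 f1 (\<alpha>, \<beta>, y)" if "x \<in> V1" for x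
    proof -
      have "k x \<in> UNIV \<times> UNIV \<times> A.V'" using k that by (rule bij_betw_apply)
      then show ?thesis using gk[OF that, symmetric] by (auto simp del: hyp_glue.simps)
    qed
    have fV: "f x \<in> V2" if "x \<in> V1" for x
      using kx[OF that] gV by (auto simp: f_def simp del: hyp_glue.simps intro!: B.glue_mem)
    have fq: "q2 (f x) = q1 x" if "x \<in> V1" for x
      using kx[OF that] gV
      by (auto simp: f_def A.q_glue B.q_glue g simp del: hyp_glue.simps)
    have fb: "sign_polar q2 (f x) (f y) = sign_polar q1 x y" if "x \<in> V1" "y \<in> V1" for x y
      using kx[OF that(1)] kx[OF that(2)] gV
      by (auto simp: f_def A.pol_glue B.pol_glue g simp del: hyp_glue.simps)
    \<comment> \<open>A map preserving a non-degenerate form is injective.\<close>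
    have "inj_on f V1"
    proof
      fix x y assume xy: "x \<in> V1" "y \<in> V1" "f x = f y"
      have "sign_polar q1 (x + y) z = 1" if z: "z \<in> V1" for z
        using fb[OF xy(1) z] fb[OF xy(2) z] xy z A.pol_sgn[of y z] by (auto simp: A.pol_add)
      then show "x = y"
        using A.pol_nondeg[of "x + y"] A.add xy A.eq_add_iff by blast
    qed
    then have "bij_betw f V1 V2"
      using fV B.fin less.prems(3)
      by (metis bij_betw_def card_image card_subset_eq image_subsetI)
    then show ?thesis using fq fb by blast
  qed
qed

text \<open>The level set of -1 is where the vertices of all graphs and two-graphs below
  live.\<close>

lemma signed_form_isometry_minus:
  assumes "signed_form V1 q1" "signed_form V2 q2"
    and "card V1 = card V2" "sum q1 V1 = sum q2 V2"
  shows "\<exists>f. bij_betw f {x \<in> V1. q1 x = -1} {x \<in> V2. q2 x = -1} \<and>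
    (\<forall>x\<in>V1. \<forall>y\<in>V1. sign_polar q2 (f x) (f y) = sign_polar q1 x y)"
proof -
  obtain f where f: "bij_betw f V1 V2" "\<forall>x\<in>V1. q2 (f x) = q1 x"
    "\<forall>x\<in>V1. \<forall>y\<in>V1. sign_polar q2 (f x) (f y) = sign_polar q1 x y"
    using signed_form_isometry[OF assms] by blast
  have "inj_on f {x \<in> V1. q1 x = -1}"
    using f(1) by (auto simp: bij_betw_def inj_on_def)
  moreover have "f ` {x \<in> V1. q1 x = -1} = {x \<in> V2. q2 x = -1}"
    using f(1,2) by (auto simp: bij_betw_def)
  ultimately show ?thesis
    using f(3) by (auto simp: bij_betw_def)
qed

section \<open>Gauss sums and the Witt index\<close>

text \<open>Abstracts the sign of the absolute trace, so that the fields of order 2 and 4 share one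
  argument. \<open>chi_square\<close> is the invariance of the trace under Frobenius.\<close>

locale char2_character =
  fixes \<chi> :: "'f::{field,finite} \<Rightarrow> int"
  assumes two_zero: "(1::'f) + 1 = 0"
    and chi_add: "\<chi> (x + y) = \<chi> x * \<chi> y"
    and chi_sgn: "\<chi> x = 1 \<or> \<chi> x = -1"
    and chi_square: "\<chi> (x * x) = \<chi> x"
    and chi_nontrivial: "\<exists>x. \<chi> x = -1"
begin

lemma two_eq_zero [simp]: "(2::'f) = 0"
  using two_zero by simp

lemma add_self: "(x::'f) + x = 0"
  by simp

lemma add_eq_zero: "(x::'f) + y = 0 \<longleftrightarrow> x = y"
  by (metis add.assoc add.right_neutral add_self add_0)

lemma vec_add_self: "(x::'f vec) + x = 0"
  by (rule ext) simp

lemma vec_add_eq_zero: "(x::'f vec) + y = 0 \<longleftrightarrow> x = y"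
  by (auto simp: fun_eq_iff add_eq_zero)

lemma chi_zero: "\<chi> 0 = 1"
  using chi_add[of 0 0] chi_sgn[of 0] by auto

lemma chi_scale_nontrivial: "y \<noteq> 0 \<Longrightarrow> \<exists>c. \<chi> (c * y) = -1"
proof -
  assume "y \<noteq> 0"
  obtain x where "\<chi> x = -1" using chi_nontrivial by blast
  then have "\<chi> ((x / y) * y) = -1" using \<open>y \<noteq> 0\<close> by simp
  then show ?thesis by blast
qed

text \<open>Squaring is additive in characteristic 2, hence injective, hence surjective on a finite
  field.\<close>

lemma sqrt_exists: "\<exists>r::'f. r * r = x"
proof -
  have "inj (\<lambda>r::'f. r * r)"
  proof
    fix r t :: 'f assume "r * r = t * t"
    moreover have "(r + t) * (r + t) = r * r + t * t + (r * t + r * t)"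
      by (simp add: algebra_simps)
    ultimately have "(r + t) * (r + t) = 0"
      by simp
    then show "r = t" by (simp add: add_eq_zero)
  qed
  then have "surj (\<lambda>r::'f. r * r)" by (simp add: finite_UNIV_inj_surj)
  then show ?thesis by (metis surjD)
qed

lemma sum_chi: "(\<Sum>x\<in>UNIV. \<chi> x) = 0"
proof -
  obtain t where t: "\<chi> t = -1" using chi_nontrivial by blast
  have "bij (\<lambda>x. x + t)"
    by (intro bij_betw_byWitness[where f' = "\<lambda>x. x - t"]) auto
  then have "(\<Sum>x\<in>UNIV. \<chi> x) = (\<Sum>x\<in>UNIV. \<chi> (x + t))"
    by (rule sum.reindex_bij_betw[symmetric])
  also have "\<dots> = - (\<Sum>x\<in>UNIV. \<chi> x)"
    by (simp add: chi_add t sum_negf)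
  finally show ?thesis by simp
qed

text \<open>With \<open>y = r * r\<close> the argument is the square of \<open>c * r\<close>, and
  \<open>\<chi>\<close> does not see the squaring. The full character sum is 0, and its term at
  \<open>c = 0\<close> is 1.\<close>

lemma sum_chi_scale:
  assumes "y \<noteq> 0"
  shows "(\<Sum>c\<in>UNIV - {0}. \<chi> (c * c * y)) = -1"
proof -
  obtain r where r: "r * r = y" using sqrt_exists by blast
  then have "r \<noteq> 0" using assms by auto
  have "(\<Sum>c\<in>UNIV. \<chi> (c * c * y)) = (\<Sum>c\<in>UNIV. \<chi> (c * r))"
    by (intro sum.cong refl) (simp add: chi_square mult_ac flip: r chi_square[of "_ * r"])
  also have "\<dots> = (\<Sum>x\<in>UNIV. \<chi> x)"
    using \<open>r \<noteq> 0\<close>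
    by (intro sum.reindex_bij_betw bij_betw_byWitness[where f' = "\<lambda>x. x / r"]) auto
  finally have "(\<Sum>c\<in>UNIV. \<chi> (c * c * y)) = 0" by (simp add: sum_chi)
  then show ?thesis
    by (simp add: sum_diff1 chi_zero)
qed

end

section \<open>Spans, independence and counting\<close>

lemma vadd_eq: "vadd x y = x + y"
  by (simp add: vadd_def plus_fun_def)

lemma vzero_eq: "vzero = (0 :: ('a::zero) vec)"
  by (simp add: vzero_def zero_fun_def)

lemma card_vecs: "card (vecs n :: ('f::{zero,finite}) vec set) = CARD('f) ^ n"
  and finite_vecs: "finite (vecs n :: ('f::{zero,finite}) vec set)"
proof -
  have "bij_betw (\<lambda>g i. if i < n then g i else 0)
     (PiE {..<n} (\<lambda>_. UNIV :: 'f set)) (vecs n)"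
  proof (rule bij_betw_byWitness[where f' = "\<lambda>x. restrict x {..<n}"])
    show "\<forall>g\<in>{..<n} \<rightarrow>\<^sub>E UNIV. restrict (\<lambda>i. if i < n then g i else (0::'f)) {..<n} = g"
      by (intro ballI ext) (simp add: restrict_def PiE_def extensional_def)
    show "\<forall>x\<in>vecs n. (\<lambda>i. if i < n then restrict x {..<n} i else 0) = (x :: 'f vec)"
      by (intro ballI ext) (simp add: vecs_def)
  qed (simp_all add: vecs_def image_subset_iff)
  from bij_betw_same_card[OF this] bij_betw_finite[OF this]
  show "card (vecs n :: 'f vec set) = CARD('f) ^ n" "finite (vecs n :: 'f vec set)"
    by (simp_all add: card_PiE finite_PiE)
qed

lemma lincomb_add: "lincomb k c vs + lincomb k d vs = lincomb k (c + d) (vs :: nat \<Rightarrow> ('f::field) vec)"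
  by (rule ext) (simp add: lincomb_def sum.distrib distrib_right)

lemma smul_lincomb: "smul a (lincomb k c vs) = lincomb k (smul a c) (vs :: nat \<Rightarrow> ('f::field) vec)"
  by (rule ext) (simp add: lincomb_def smul_def sum_distrib_left mult.assoc)

text \<open>Coefficient functions in \<open>span_of\<close> are arbitrary from \<open>k\<close> on;
  cutting them to 0 there gives a finite parameter set, which is what the counting needs.\<close>

lemma span_of_eq: "span_of k vs = (\<lambda>c. lincomb k c vs) ` vecs k"
proof -
  have "lincomb k c vs = lincomb k (\<lambda>i. if i < k then c i else 0) vs" for c
    by (auto simp: lincomb_def intro!: sum.cong)
  moreover have "(\<lambda>i. if i < k then c i else 0) \<in> vecs k" for c
    by (simp add: vecs_def)
  ultimately show ?thesis
    unfolding span_of_def by blast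
qed

lemma lincomb_Suc: "lincomb (Suc k) c vs = lincomb k c vs + smul (c k) (vs k)"
  by (rule ext) (simp add: lincomb_def smul_def)

lemma lincomb_0: "lincomb 0 c vs = 0"
  by (rule ext) (simp add: lincomb_def)

lemma lin_indep_inj:
  fixes vs :: "nat \<Rightarrow> ('f::field) vec"
  assumes "lin_indep k vs"
  shows "inj_on (\<lambda>c. lincomb k c vs) (vecs k)"
proof
  fix c d assume cd: "c \<in> vecs k" "d \<in> vecs k" "lincomb k c vs = lincomb k d vs"
  have "lincomb k (\<lambda>j. c j - d j) vs = vzero"
    using fun_cong[OF cd(3)]
    by (auto simp: lincomb_def vzero_def left_diff_distrib sum_subtractf)
  then have "\<forall>j<k. c j - d j = 0"
    using assms unfolding lin_indep_def by (elim allE) (erule mp)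
  then show "c = d"
    using cd(1,2) by (auto simp: vecs_def fun_eq_iff) (metis leI)
qed

lemma card_span:
  fixes vs :: "nat \<Rightarrow> ('f::{field,finite}) vec"
  assumes "lin_indep k vs"
  shows "card (span_of k vs) = CARD('f) ^ k"
  unfolding span_of_eq using card_image[OF lin_indep_inj[OF assms]] by (simp add: card_vecs)

lemma span_add: "x \<in> span_of k vs \<Longrightarrow> y \<in> span_of k vs \<Longrightarrow> x + y \<in> span_of k (vs :: nat \<Rightarrow> ('f::field) vec)"
  unfolding span_of_def using lincomb_add by blast

lemma span_smul: "x \<in> span_of k vs \<Longrightarrow> smul a x \<in> span_of k (vs :: nat \<Rightarrow> ('f::field) vec)"
  unfolding span_of_def using smul_lincomb by blast

lemma span_zero: "0 \<in> span_of k (vs :: nat \<Rightarrow> ('f::field) vec)"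
proof -
  have "lincomb k (\<lambda>_. 0) vs = 0" by (rule ext) (simp add: lincomb_def)
  then show ?thesis unfolding span_of_def by (metis rangeI)
qed

lemma span_base: "j < k \<Longrightarrow> vs j \<in> span_of k (vs :: nat \<Rightarrow> ('f::field) vec)"
proof -
  assume "j < k"
  have "lincomb k (\<lambda>i. if i = j then 1 else 0) vs = vs j"
    by (rule ext) (use \<open>j < k\<close> in \<open>simp add: lincomb_def if_distrib[of "\<lambda>x. x * _"] cong: if_cong\<close>)
  then show ?thesis unfolding span_of_def by (metis rangeI)
qed

lemma smul_simps:
  fixes x y :: "('f::field) vec"
  shows "smul 0 x = 0" "smul 1 x = x" "smul a (smul b x) = smul (a * b) x"
    "smul a (x + y) = smul a x + smul a y" "smul (a + b) x = smul a x + smul b x" "smul a 0 = (0 :: 'f vec)"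
    "smul a x = 0 \<longleftrightarrow> a = 0 \<or> x = 0"
  by (auto simp: smul_def fun_eq_iff algebra_simps)

lemma lin_indep_extend:
  fixes vs :: "nat \<Rightarrow> ('f::field) vec"
  assumes vs: "lin_indep k vs" and x: "x \<notin> span_of k vs"
  shows "lin_indep (Suc k) (vs(k := x))"
proof -
  have *: "lincomb (Suc k) c (vs(k := x)) = lincomb k c vs + smul (c k) x" for c
    by (rule ext) (simp add: lincomb_def smul_def)
  show ?thesis
    unfolding lin_indep_def
  proof (intro allI impI)
    fix c j assume "lincomb (Suc k) c (vs(k := x)) = vzero" and j: "j < Suc k"
    then have 0: "lincomb k c vs + smul (c k) x = 0" by (simp add: * vzero_eq)
    have ck: "c k = 0"
    proof (rule ccontr)
      assume ck: "c k \<noteq> 0"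
      have "x = smul (- inverse (c k)) (lincomb k c vs)"
      proof
        fix i
        have "lincomb k c vs i + c k * x i = 0"
          using fun_cong[OF 0, of i] by (simp add: smul_def)
        then have "lincomb k c vs i = - (c k * x i)"
          by (simp add: eq_neg_iff_add_eq_0)
        then show "x i = smul (- inverse (c k)) (lincomb k c vs) i"
          using ck by (simp add: smul_def)
      qed
      then have "x \<in> span_of k vs"
        by (metis span_smul span_of_def rangeI)
      then show False using x by contradiction
    qed
    then have "lincomb k c vs = vzero"
      using 0 by (simp add: smul_simps vzero_eq)
    then show "c j = 0"
      using vs j ck by (auto simp: lin_indep_def less_Suc_eq)
  qed
qed

lemma lincomb_in_subspace:
  fixes W :: "('f::field) vec set"
  assumes "0 \<in> W" "\<And>x y. x \<in> W \<Longrightarrow> y \<in> W \<Longrightarrow> x + y \<in> W" "\<And>a x. x \<in> W \<Longrightarrow> smul a x \<in> W"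
    and "\<And>j. j < k \<Longrightarrow> vs j \<in> W"
  shows "lincomb k c vs \<in> W"
  using assms(4) by (induction k) (auto simp: lincomb_Suc lincomb_0 assms(1-3))

lemma span_subset:
  fixes W :: "('f::field) vec set"
  assumes "0 \<in> W" "\<And>x y. x \<in> W \<Longrightarrow> y \<in> W \<Longrightarrow> x + y \<in> W" "\<And>a x. x \<in> W \<Longrightarrow> smul a x \<in> W"
    and "\<And>j. j < k \<Longrightarrow> vs j \<in> W"
  shows "span_of k vs \<subseteq> W"
  using lincomb_in_subspace[of W k vs, OF assms] by (auto simp: span_of_def)

section \<open>Quadratic spaces in characteristic 2 and their Gauss sums\<close>

text \<open>The form is constrained only on \<open>W\<close>, so the structure passes to any
  subspace with the same \<open>\<Theta>\<close>.\<close>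

locale quadratic_space = char2_character \<chi> for \<chi> :: "'f::{field,finite} \<Rightarrow> int" +
  fixes W :: "'f vec set" and \<Theta> :: "'f vec \<Rightarrow> 'f"
  assumes W_fin: "finite W" and W_zero: "0 \<in> W"
    and W_add: "x \<in> W \<Longrightarrow> y \<in> W \<Longrightarrow> x + y \<in> W"
    and W_smul: "x \<in> W \<Longrightarrow> smul a x \<in> W"
    and Theta_smul: "x \<in> W \<Longrightarrow> \<Theta> (smul a x) = a * a * \<Theta> x"
    and polar_add: "x \<in> W \<Longrightarrow> y \<in> W \<Longrightarrow> z \<in> W \<Longrightarrow> polar \<Theta> (x + y) z = polar \<Theta> x z + polar \<Theta> y z"
    and polar_smul: "x \<in> W \<Longrightarrow> z \<in> W \<Longrightarrow> polar \<Theta> (smul a x) z = a * polar \<Theta> x z"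
begin

lemma polar_sym: "polar \<Theta> x y = polar \<Theta> y x"
  by (simp add: polar_def vadd_eq add_ac)

lemma Theta_add: "\<Theta> (x + y) = \<Theta> x + \<Theta> y + polar \<Theta> x y"
proof -
  have "\<Theta> x + \<Theta> y + polar \<Theta> x y = \<Theta> (x + y) + (\<Theta> x + \<Theta> x) + (\<Theta> y + \<Theta> y)"
    by (simp only: polar_def vadd_eq add_ac)
  then show ?thesis by (simp add: add_self)
qed

lemma Theta_zero: "\<Theta> 0 = 0"
  using Theta_smul[OF W_zero, of 0] by (simp add: smul_simps)

lemma polar_zero: "x \<in> W \<Longrightarrow> polar \<Theta> 0 x = 0" "x \<in> W \<Longrightarrow> polar \<Theta> x 0 = 0"
  using polar_smul[OF W_zero, of x 0] by (simp_all add: smul_simps polar_sym[of x])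

lemma polar_self: "x \<in> W \<Longrightarrow> polar \<Theta> x x = 0"
  by (simp add: polar_def vadd_eq vec_add_self Theta_zero add_self)

lemma polar_add_right: "x \<in> W \<Longrightarrow> y \<in> W \<Longrightarrow> z \<in> W \<Longrightarrow> polar \<Theta> z (x + y) = polar \<Theta> z x + polar \<Theta> z y"
  using polar_add by (simp add: polar_sym)

lemma polar_smul_right: "x \<in> W \<Longrightarrow> z \<in> W \<Longrightarrow> polar \<Theta> z (smul a x) = a * polar \<Theta> z x"
  using polar_smul by (simp add: polar_sym)

lemma subspace:
  assumes "H \<subseteq> W" "0 \<in> H" "\<And>x y. x \<in> H \<Longrightarrow> y \<in> H \<Longrightarrow> x + y \<in> H" "\<And>a x. x \<in> H \<Longrightarrow> smul a x \<in> H"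
  shows "quadratic_space \<chi> H \<Theta>"
proof
  show "finite H" using assms(1) W_fin finite_subset by blast
qed (use assms Theta_smul polar_add polar_smul in \<open>auto simp: subset_iff\<close>)

abbreviation sq :: "'f vec \<Rightarrow> int" where "sq x \<equiv> \<chi> (\<Theta> x)"

lemma pol_sq: "sign_polar sq x y = \<chi> (polar \<Theta> x y)"
  by (simp add: sign_polar_def polar_def vadd_eq chi_add)

lemma sq_smul_sum:
  "\<Theta> x \<noteq> 0 \<Longrightarrow> x \<in> W \<Longrightarrow> (\<Sum>c\<in>UNIV - {0}. sq (smul c x)) = -1"
  by (simp add: Theta_smul sum_chi_scale)

end

locale nondeg_space = quadratic_space +
  assumes W_nondeg: "nondeg \<Theta> W"
begin

lemma nondegD: "x \<in> W \<Longrightarrow> (\<And>y. y \<in> W \<Longrightarrow> polar \<Theta> x y = 0) \<Longrightarrow> x = 0"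
  using W_nondeg by (auto simp: nondeg_def rad_def vzero_eq)

text \<open>Passing to signs keeps non-degeneracy: if \<open>polar \<Theta> x y\<close> is non-zero,
  some scalar multiple of \<open>y\<close> pairs with \<open>x\<close> to a value of sign
  -1.\<close>

sublocale signed: signed_form W sq
proof
  show "sign_polar sq (x + y) z = sign_polar sq x z * sign_polar sq y z" if "x \<in> W" "y \<in> W" "z \<in> W" for x y z
    using that by (simp add: pol_sq polar_add chi_add)
  show "x = 0" if x: "x \<in> W" and h: "\<And>y. y \<in> W \<Longrightarrow> sign_polar sq x y = 1" for x
  proof (rule nondegD[OF x], rule ccontr)
    fix y assume y: "y \<in> W" "polar \<Theta> x y \<noteq> 0"
    then obtain c where "\<chi> (c * polar \<Theta> x y) = -1" using chi_scale_nontrivial by blast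
    then have "sign_polar sq x (smul c y) = -1" using x y by (simp add: pol_sq polar_smul_right)
    then show False using h[OF W_smul[OF y(1), of c]] by simp
  qed
qed (simp_all add: W_fin W_zero W_add vec_add_self chi_sgn)

text \<open>For a totally singular \<open>U\<close> of dimension \<open>k\<close>, the sum over
  \<open>W\<close> equals the sum over the perp \<open>P\<close> of \<open>U\<close>. On
  \<open>U\<close> it is the cardinality of \<open>U\<close>; on \<open>P - U\<close> the form is
  anisotropic by maximality, and the non-zero multiples of each vector contribute -1 in
  total.\<close>

lemma gauss_sum_tot_sing:
  assumes k: "tot_sing \<Theta> W k" and max: "\<not> tot_sing \<Theta> W (Suc k)" and n: "card W = CARD('a) ^ n"
  shows "k \<le> n" and "(int CARD('a) - 1) * sum sq W = int CARD('a) ^ (k + 1) - int CARD('a) ^ (n - k)"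
proof -
  let ?p = "int CARD('a)"
  obtain vs where vs: "\<forall>j<k. vs j \<in> W" "lin_indep k vs" "\<forall>u\<in>span_of k vs. \<Theta> u = 0"
    using k unfolding tot_sing_def by blast
  define U where "U = span_of k vs"
  have U: "U \<subseteq> W" "0 \<in> U" "\<And>x y. x \<in> U \<Longrightarrow> y \<in> U \<Longrightarrow> x + y \<in> U" "\<And>a x. x \<in> U \<Longrightarrow> smul a x \<in> U"
    unfolding U_def using span_subset[of W k vs] W_zero W_add W_smul vs(1)
    by (auto simp: span_zero span_add span_smul)
  have ThU: "\<Theta> u = 0" if "u \<in> U" for u
    using vs(3) that by (simp add: U_def)
  have cU: "card U = CARD('a) ^ k"
    unfolding U_def by (rule card_span[OF vs(2)])
  have p1: "CARD('a) > 1"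
    using card_mono[of UNIV "{0, 1::'a}"] by simp
  have fU: "finite U" using U(1) W_fin finite_subset by blast
  have "CARD('a) ^ k \<le> CARD('a) ^ n"
    using card_mono[OF W_fin U(1)] cU n by simp
  then show kn: "k \<le> n" using p1 power_le_imp_le_exp by blast
  define P where "P = signed.perp U"
  have UP: "U \<subseteq> P"
  proof -
    have "polar \<Theta> x y = 0" if "x \<in> U" "y \<in> U" for x y
      using that U by (simp add: polar_def vadd_eq ThU)
    then show ?thesis
      using U(1) by (auto simp: P_def pol_sq chi_zero)
  qed
  have PW: "P \<subseteq> W" by (auto simp: P_def)
  have fP: "finite P" using PW W_fin finite_subset by blast
  \<comment> \<open>\<open>P\<close> is defined through signs only; closure of \<open>U\<close>
    under scalars upgrades this to orthogonality over the field.\<close>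
  have P_polar: "polar \<Theta> x u = 0" if "x \<in> P" "u \<in> U" for x u
  proof (rule ccontr)
    assume "polar \<Theta> x u \<noteq> 0"
    then obtain c where "\<chi> (c * polar \<Theta> x u) = -1" using chi_scale_nontrivial by blast
    then have "sign_polar sq x (smul c u) = -1"
      using that U PW by (simp add: pol_sq polar_smul_right subset_iff)
    moreover have "sign_polar sq x (smul c u) = 1"
      using that U by (simp add: P_def)
    ultimately show False by simp
  qed
  have P_smul: "smul c x \<in> P" if "x \<in> P" for c x
    using that PW U(1) P_polar[OF that]
    by (auto simp: P_def W_smul pol_sq polar_smul chi_zero subset_iff)
  \<comment> \<open>Otherwise adjoining \<open>x\<close> to the basis of \<open>U\<close> yields a
    totally singular subspace of dimension \<open>k + 1\<close>.\<close>
  have aniso: "\<Theta> x \<noteq> 0" if "x \<in> P - U" for x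
  proof
    assume "\<Theta> x = 0"
    have "\<Theta> w = 0" if w: "w \<in> span_of (Suc k) (vs(k := x))" for w
    proof -
      obtain c where "w = lincomb (Suc k) c (vs(k := x))" using w by (auto simp: span_of_def)
      moreover have "lincomb k c (vs(k := x)) = lincomb k c vs"
        by (simp add: lincomb_def fun_eq_iff)
      ultimately have w_eq: "w = lincomb k c vs + smul (c k) x"
        by (simp add: lincomb_Suc)
      have l: "lincomb k c vs \<in> U" by (auto simp: U_def span_of_def)
      have "polar \<Theta> (lincomb k c vs) (smul (c k) x) = 0"
        using P_polar[OF P_smul l] \<open>x \<in> P - U\<close> by (simp add: polar_sym[of "lincomb k c vs"])
      then show ?thesis
        using \<open>x \<in> P - U\<close> PW
        by (auto simp: w_eq Theta_add ThU[OF l] Theta_smul \<open>\<Theta> x = 0\<close> subset_iff)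
    qed
    moreover have "lin_indep (Suc k) (vs(k := x))"
      using lin_indep_extend[OF vs(2)] that by (simp add: U_def)
    moreover have "\<forall>j<Suc k. (vs(k := x)) j \<in> W"
      using vs(1) that PW by (auto simp: less_Suc_eq)
    ultimately show False
      using max unfolding tot_sing_def by blast
  qed
  have "card U * card P = card W"
    using signed.card_perp[OF U(1,2,3)] unfolding P_def by (simp flip: of_nat_mult)
  then have "CARD('a) ^ k * card P = CARD('a) ^ k * CARD('a) ^ (n - k)"
    using kn by (simp add: cU n flip: power_add)
  then have cP: "card P = CARD('a) ^ (n - k)"
    using p1 by simp
  \<comment> \<open>Each non-zero scalar permutes \<open>P - U\<close>, so the sum is repeated once
    per scalar; swapping the sums then isolates the contribution of the multiples of a single
    vector.\<close>
  have "(?p - 1) * sum sq (P - U) = (\<Sum>c\<in>UNIV - {0::'a}. \<Sum>x\<in>P - U. sq (smul c x))"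
  proof -
    have "(\<Sum>x\<in>P - U. sq (smul c x)) = sum sq (P - U)" if "c \<noteq> 0" for c
    proof (intro sum.reindex_bij_betw bij_betw_byWitness[where f' = "smul (inverse c)"])
      have 1: "smul d x \<in> P - U" if "d \<noteq> 0" "x \<in> P - U" for d x
      proof -
        have "smul (inverse d) (smul d x) = x" using that by (simp add: smul_simps)
        then show ?thesis using that P_smul U(4)[of "smul d x" "inverse d"] by auto
      qed
      show "smul c ` (P - U) \<subseteq> P - U" "smul (inverse c) ` (P - U) \<subseteq> P - U"
        using 1 that by auto
    qed (use that in \<open>auto simp: smul_simps\<close>)
    then show ?thesis by (simp add: card_Diff_subset of_nat_diff p1 Suc_leI)
  qed
  also have "\<dots> = (\<Sum>x\<in>P - U. \<Sum>c\<in>UNIV - {0::'a}. sq (smul c x))"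
    by (rule sum.swap)
  also have "\<dots> = (\<Sum>x\<in>P - U. -1)"
    using aniso PW by (intro sum.cong refl sq_smul_sum) auto
  also have "\<dots> = ?p ^ k - ?p ^ (n - k)"
    using card_mono[OF fP UP] by (simp add: card_Diff_subset fU UP cU cP of_nat_diff)
  finally have PU: "(?p - 1) * sum sq (P - U) = ?p ^ k - ?p ^ (n - k)" .
  have "sum sq W = sum sq P"
    unfolding P_def using U ThU by (intro signed.sum_eq_sum_perp) (auto simp: chi_zero)
  also have "\<dots> = sum sq (P - U) + sum sq U"
    by (rule sum.subset_diff[OF UP fP])
  also have "sum sq U = ?p ^ k"
    by (simp add: ThU chi_zero cU)
  finally have "(?p - 1) * sum sq W = ?p ^ k - ?p ^ (n - k) + (?p - 1) * ?p ^ k"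
    using PU by (simp add: distrib_left)
  then show "(?p - 1) * sum sq W = ?p ^ (k + 1) - ?p ^ (n - k)"
    by (simp add: algebra_simps)
qed

end

text \<open>\<open>GREATEST\<close> is meaningful only with a bound: a totally singular span of
  dimension \<open>k\<close> has at least \<open>2 ^ k > k\<close> vectors, all in the finite set
  \<open>W\<close>.\<close>

lemma (in quadratic_space) witt_index_tot_sing:
  shows "tot_sing \<Theta> W (witt_index \<Theta> W)" and "\<not> tot_sing \<Theta> W (Suc (witt_index \<Theta> W))"
proof -
  have bound: "k \<le> card W" if "tot_sing \<Theta> W k" for k
  proof -
    obtain vs where vs: "\<forall>j<k. vs j \<in> W" "lin_indep k vs"
      using \<open>tot_sing \<Theta> W k\<close> unfolding tot_sing_def by blast
    have "span_of k vs \<subseteq> W"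
      using vs by (intro span_subset W_zero W_add W_smul) auto
    then have "CARD('f) ^ k \<le> card W"
      using card_mono[OF W_fin] card_span[OF vs(2)] by metis
    moreover have "CARD('f) > 1"
      using card_mono[of UNIV "{0, 1::'f}"] by simp
    ultimately show ?thesis
      using less_exp[of k] power_mono[of 2 "CARD('f)" k] by linarith
  qed
  have "tot_sing \<Theta> W 0"
    unfolding tot_sing_def by (auto simp: lin_indep_def span_of_def lincomb_0 Theta_zero)
  then show "tot_sing \<Theta> W (witt_index \<Theta> W)"
    unfolding witt_index_def using bound by (rule GreatestI_nat)
  show "\<not> tot_sing \<Theta> W (Suc (witt_index \<Theta> W))"
    using Greatest_le_nat[of "tot_sing \<Theta> W" "Suc (witt_index \<Theta> W)" "card W"] bound
    unfolding witt_index_def by auto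
qed

text \<open>The Gauss sum has square \<open>CARD('a) ^ (2 * m)\<close>, which leaves two values; the
  formula in terms of the Witt index matches them with \<open>m\<close> and
  \<open>m - 1\<close>.\<close>

lemma (in nondeg_space) witt_index_gauss_sum:
  assumes card: "card W = CARD('a) ^ (2 * m)" and m: "m \<ge> 1"
  shows "sum sq W = int CARD('a) ^ m \<or> sum sq W = - (int CARD('a) ^ m)"
    and "witt_index \<Theta> W = (if s then m else m - 1) \<longleftrightarrow>
      sum sq W = (if s then int CARD('a) ^ m else - (int CARD('a) ^ m))"
proof -
  let ?p = "int CARD('a)"
  define k where "k = witt_index \<Theta> W"
  have p1: "?p > 1"
    using card_mono[of UNIV "{0, 1::'a}"] by simp
  have k: "k \<le> 2 * m" "(?p - 1) * sum sq W = ?p ^ (k + 1) - ?p ^ (2 * m - k)"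
    using gauss_sum_tot_sing[OF witt_index_tot_sing card] by (simp_all add: k_def)
  have "sum sq W * sum sq W = ?p ^ m * ?p ^ m"
    using signed.gauss_sum_square card by (simp add: mult_2 power_add)
  then show sq: "sum sq W = ?p ^ m \<or> sum sq W = - (?p ^ m)"
    by (simp add: square_eq_iff)
  \<comment> \<open>\<open>h\<close> is strictly increasing, so the Gauss sum determines the Witt index.\<close>
  define h where "h j = ?p ^ (j + 1) - ?p ^ (2 * m - j)" for j
  have h_mono: "h i < h j" if "i < j" "j \<le> 2 * m" for i j
  proof -
    have "?p ^ (i + 1) < ?p ^ (j + 1)" "?p ^ (2 * m - j) < ?p ^ (2 * m - i)"
      using that p1 by (auto intro!: power_strict_increasing)
    then show ?thesis unfolding h_def by linarith
  qed
  have h_inj: "h i = h j \<longleftrightarrow> i = j" if "i \<le> 2 * m" "j \<le> 2 * m" for i j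
    using h_mono[of i j] h_mono[of j i] that by (cases i j rule: linorder_cases) auto
  have hm: "h m = (?p - 1) * ?p ^ m"
    by (simp add: h_def algebra_simps)
  \<comment> \<open>Natural subtraction: \<open>m \<ge> 1\<close> is what makes this true.\<close>
  have "2 * m - (m - 1) = m + 1" using m by simp
  then have hm1: "h (m - 1) = (?p - 1) * - (?p ^ m)"
    using m by (simp add: h_def algebra_simps)
  have hk: "h k = (?p - 1) * sum sq W"
    using k(2) by (simp add: h_def)
  have p0: "?p - 1 \<noteq> 0" using p1 by simp
  have "k = m \<longleftrightarrow> sum sq W = ?p ^ m"
    using h_inj[of k m] k(1) p0 unfolding hm hk mult_cancel_left by auto
  moreover have "k = m - 1 \<longleftrightarrow> sum sq W = - (?p ^ m)"
    using h_inj[of k "m - 1"] k(1) p0 unfolding hm1 hk mult_cancel_left by auto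
  ultimately show "witt_index \<Theta> W = (if s then m else m - 1) \<longleftrightarrow>
      sum sq W = (if s then ?p ^ m else - (?p ^ m))"
    by (simp add: k_def)
qed

section \<open>Forms given by coefficients\<close>

lemma vecs_closed:
  fixes x y :: "('f::field) vec"
  shows "0 \<in> (vecs n :: 'f vec set)" "x \<in> vecs n \<Longrightarrow> y \<in> vecs n \<Longrightarrow> x + y \<in> vecs n"
    "x \<in> vecs n \<Longrightarrow> smul a x \<in> vecs n"
  by (simp_all add: vecs_def smul_def)

text \<open>In the expansion of the polar form the pure \<open>x\<close> and pure \<open>y\<close>
  terms occur twice and cancel, leaving an expression bilinear in \<open>x\<close> and
  \<open>y\<close>.\<close>

lemma (in char2_character) quadratic_space_vecs:
  assumes "is_qform n \<Theta>"
  shows "quadratic_space \<chi> (vecs n) \<Theta>"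
proof -
  obtain c where c: "\<And>x. x \<in> vecs n \<Longrightarrow> \<Theta> x = (\<Sum>i<n. \<Sum>j\<in>{i..<n}. c i j * x i * x j)"
    using assms unfolding is_qform_def by blast
  have polar: "polar \<Theta> x y = (\<Sum>i<n. \<Sum>j\<in>{i..<n}. c i j * (x i * y j + y i * x j))"
    if "x \<in> vecs n" "y \<in> vecs n" for x y
  proof -
    have "polar \<Theta> x y = (\<Sum>i<n. \<Sum>j\<in>{i..<n}. c i j * (x i + y i) * (x j + y j) +
        c i j * x i * x j + c i j * y i * y j)"
      using that by (simp add: polar_def vadd_eq c vecs_closed sum.distrib)
    also have "\<dots> = (\<Sum>i<n. \<Sum>j\<in>{i..<n}. c i j * (x i * y j + y i * x j))"
    proof (intro sum.cong refl)
      fix i j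
      have "c i j * (x i + y i) * (x j + y j) + c i j * x i * x j + c i j * y i * y j =
        c i j * (x i * y j + y i * x j) + 2 * (c i j * x i * x j + c i j * y i * y j)"
        by (simp only: mult_2) (simp add: algebra_simps)
      then show "c i j * (x i + y i) * (x j + y j) + c i j * x i * x j + c i j * y i * y j =
        c i j * (x i * y j + y i * x j)"
        by simp
    qed
    finally show ?thesis .
  qed
  show ?thesis
  proof
    show "\<Theta> (smul a x) = a * a * \<Theta> x" if "x \<in> vecs n" for a x
      using that
      by (simp add: c vecs_closed sum_distrib_left) (simp add: smul_def mult_ac)
    show "polar \<Theta> (x + y) z = polar \<Theta> x z + polar \<Theta> y z"
      if "x \<in> vecs n" "y \<in> vecs n" "z \<in> vecs n" for x y z
      using that by (simp add: polar vecs_closed algebra_simps sum.distrib)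
    show "polar \<Theta> (smul a x) z = a * polar \<Theta> x z" if "x \<in> vecs n" "z \<in> vecs n" for a x z
      using that
      by (simp add: polar vecs_closed sum_distrib_left) (simp add: smul_def algebra_simps)
  qed (simp_all add: finite_vecs vecs_closed)
qed

section \<open>The fields of order 2 and 4 and their trace characters\<close>

text \<open>Translation by 1 permutes the field, so adding 1 to every element leaves the total
  unchanged. For orders 2 and 4 this yields characteristic 2.\<close>

lemma of_nat_card_field: "of_nat CARD('f::{field,finite}) = (0::'f)"
proof -
  have "bij (\<lambda>x::'f. x + 1)"
    by (intro bij_betw_byWitness[where f' = "\<lambda>x. x - 1"]) auto
  then have "(\<Sum>x\<in>UNIV. x) = (\<Sum>x\<in>UNIV. x + (1::'f))"
    by (rule sum.reindex_bij_betw[symmetric])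
  then show ?thesis by (simp add: sum.distrib)
qed

definition chi2 :: "'f::zero \<Rightarrow> int" where
  "chi2 x = (if x = 0 then 1 else -1)"

text \<open>The trace \<open>x + x * x\<close> to the prime field vanishes exactly at 0 and
  1.\<close>

definition chi4 :: "'f::zero_neq_one \<Rightarrow> int" where
  "chi4 x = (if x = 0 \<or> x = 1 then 1 else -1)"

lemma field2_elements:
  assumes "CARD('f::{field,finite}) = 2"
  shows "(x::'f) = 0 \<or> x = 1"
proof -
  have "{0, 1::'f} = UNIV"
    using assms by (intro card_subset_eq) auto
  then show ?thesis by blast
qed

lemma chi2_character:
  assumes "CARD('f::{field,finite}) = 2"
  shows "char2_character (chi2 :: 'f \<Rightarrow> int)"
proof
  have two: "(2::'f) = 0"
    using of_nat_card_field[where 'f = 'f] by (simp add: assms)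
  then show "(1::'f) + 1 = 0" by simp
  show "chi2 (x + y) = chi2 x * chi2 y" for x y :: 'f
    using field2_elements[OF assms, of x] field2_elements[OF assms, of y] two
    by (auto simp: chi2_def)
  show "\<exists>x::'f. chi2 x = -1"
    by (rule exI[of _ 1]) (simp add: chi2_def)
qed (auto simp: chi2_def)

lemma field4_two:
  assumes "CARD('f::{field,finite}) = 4"
  shows "(2::'f) = 0"
proof -
  have "(2::'f) * 2 = 0"
    using of_nat_card_field[where 'f = 'f] by (simp add: assms)
  then show ?thesis by (simp only: mult_eq_0_iff) simp
qed

text \<open>The square of \<open>w\<close> is neither 0 nor \<open>w\<close>, and it is not 1
  because \<open>-1 = 1\<close> leaves 1 as its only square root; so it is the remaining
  element.\<close>

lemma field4_elements:
  assumes "CARD('f::{field,finite}) = 4" and w: "(w::'f) \<noteq> 0" "w \<noteq> 1"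
  shows "x = 0 \<or> x = 1 \<or> x = w \<or> x = w + 1" and "w * w = w + 1" and "w + 1 \<noteq> 0" "w + 1 \<noteq> 1"
proof -
  have two: "(2::'f) = 0" by (rule field4_two[OF assms(1)])
  have m1: "(-1::'f) = 1"
    using two by (metis add.inverse_unique one_add_one)
  show w1: "w + 1 \<noteq> 0" "w + 1 \<noteq> 1"
    using w m1 by (auto simp: add_eq_0_iff2)
  have "{0, 1, w, w + 1} = UNIV"
    using assms w1 by (intro card_subset_eq) auto
  then have all: "x = 0 \<or> x = 1 \<or> x = w \<or> x = w + 1" for x by blast
  then show "x = 0 \<or> x = 1 \<or> x = w \<or> x = w + 1" .
  have "w * w \<noteq> 1"
    using w m1 square_eq_1_iff by metis
  then show "w * w = w + 1"
    using all[of "w * w"] w by auto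
qed

lemma chi4_character:
  assumes "CARD('f::{field,finite}) = 4"
  shows "char2_character (chi4 :: 'f \<Rightarrow> int)"
proof -
  have two: "(2::'f) = 0" by (rule field4_two[OF assms])
  have "{0, 1::'f} \<noteq> UNIV"
  proof
    assume "{0, 1::'f} = UNIV"
    then have "CARD('f) = card {0, 1::'f}" by simp
    then show False using assms by simp
  qed
  then obtain w :: 'f where w: "w \<noteq> 0" "w \<noteq> 1" by blast
  note el = field4_elements[OF assms w]
  have add_two: "x + (x + y) = y" for x y :: 'f
    using two by (metis add.assoc add_0 mult_2 mult_zero_left)
  show ?thesis
  proof
    show "(1::'f) + 1 = 0" using two by simp
    show "chi4 (x + y) = chi4 x * chi4 y" for x y :: 'f
      using el(1)[of x] el(1)[of y] el(3,4) w two
      by (elim disjE) (simp_all add: chi4_def add_ac add_two)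
    show "chi4 (x * x) = chi4 x" for x :: 'f
      using el(1)[of x] el(2-4) w two
      by (elim disjE) (simp_all add: chi4_def algebra_simps add_two)
    show "\<exists>x::'f. chi4 x = -1"
      by (rule exI[of _ w]) (simp add: chi4_def w)
  qed (simp add: chi4_def)
qed

section \<open>Hyperplanes of a parabolic space\<close>

text \<open>\<open>N\<close> is a vector spanning the nucleus, scaled so that its form value is
  1.\<close>

locale parabolic_space = quadratic_space \<chi> V \<Theta>
  for \<chi> :: "'f::{field,finite} \<Rightarrow> int" and m :: nat and V and \<Theta> :: "'f vec \<Rightarrow> 'f" +
  fixes N :: "'f vec"
  assumes m: "m \<ge> 1" and V_eq: "V = vecs (2 * m + 1)"
    and N_mem: "N \<in> V" and Theta_N: "\<Theta> N = 1"
    and rad_N: "rad \<Theta> V = range (\<lambda>c. smul c N)"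

text \<open>The radical is non-zero by a Gauss sum argument, anisotropic by non-singularity, and
  then a single line because every field element is a square.\<close>

lemma (in char2_character) parabolic_spaceI:
  assumes par: "parabolic m \<Theta>" and m: "m \<ge> 1"
  shows "\<exists>N. parabolic_space \<chi> m (vecs (2 * m + 1)) \<Theta> N"
proof -
  define V :: "'f vec set" where "V = vecs (2 * m + 1)"
  interpret quadratic_space \<chi> V \<Theta>
    unfolding V_def using quadratic_space_vecs par unfolding parabolic_def by blast
  have p1: "int CARD('f) > 1"
    using card_mono[of UNIV "{0, 1::'f}"] by simp
  have aniso: "\<Theta> x \<noteq> 0" if "x \<in> rad \<Theta> V" "x \<noteq> 0" for x
    using par that unfolding parabolic_def singular_def vzero_eq V_def by blast
  \<comment> \<open>In dimension \<open>2 * m + 1\<close> with Witt index \<open>m\<close> the two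
    powers in the Gauss sum formula coincide. The sum would be 0, although its square is the
    cardinality of the space.\<close>
  have "\<not> nondeg \<Theta> V"
  proof
    assume "nondeg \<Theta> V"
    then interpret nondeg_space \<chi> V \<Theta>
      by unfold_locales
    have w: "witt_index \<Theta> V = m" using par unfolding parabolic_def V_def by blast
    have cV: "card V = CARD('f) ^ (2 * m + 1)" by (simp only: V_def card_vecs)
    have "(int CARD('f) - 1) * sum sq V = 0"
      using gauss_sum_tot_sing(2)[OF witt_index_tot_sing cV]
      by (simp add: w)
    then have "sum sq V = 0" using p1 by simp
    then have "card V = 0" using signed.gauss_sum_square by simp
    then show False by (simp add: V_def card_vecs)
  qed
  moreover have "0 \<in> rad \<Theta> V"
    using W_zero polar_zero by (simp add: rad_def)
  ultimately obtain n0 where n0: "n0 \<in> rad \<Theta> V" "n0 \<noteq> 0"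
    by (auto simp: nondeg_def vzero_eq)
  obtain r where r: "r * r = \<Theta> n0" using sqrt_exists by blast
  have r0: "r \<noteq> 0" using aniso[OF n0] r by auto
  have rad_smul: "smul c x \<in> rad \<Theta> V" if "x \<in> rad \<Theta> V" for c x
    using that by (auto simp: rad_def W_smul polar_smul)
  have rad_add: "x + y \<in> rad \<Theta> V" if "x \<in> rad \<Theta> V" "y \<in> rad \<Theta> V" for x y
    using that by (auto simp: rad_def W_add polar_add)
  define N where "N = smul (inverse r) n0"
  have N_rad: "N \<in> rad \<Theta> V" unfolding N_def using n0 by (intro rad_smul)
  have n0V: "n0 \<in> V" using n0 by (simp add: rad_def)
  have N1: "\<Theta> N = 1"
    using r0 by (simp add: N_def Theta_smul[OF n0V] field_simps flip: r)
  \<comment> \<open>For \<open>t * t = \<Theta> x\<close> the radical vector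
    \<open>x + smul t N\<close> has form value \<open>\<Theta> x + \<Theta> x = 0\<close>, so it
    vanishes by anisotropy.\<close>
  have "x \<in> range (\<lambda>c. smul c N)" if x: "x \<in> rad \<Theta> V" for x
  proof -
    obtain t where t: "t * t = \<Theta> x" using sqrt_exists by blast
    have "N \<in> V" "smul t N \<in> V" using N_rad rad_smul[OF N_rad, of t] by (auto simp: rad_def)
    then have "\<Theta> (x + smul t N) = 0"
      using x by (simp add: Theta_add Theta_smul N1 t rad_def)
    then have "x + smul t N = 0"
      using aniso rad_add[OF x rad_smul[OF N_rad]] by blast
    then have "x = smul t N" by (simp only: vec_add_eq_zero)
    then show ?thesis by blast
  qed
  then have "rad \<Theta> V = range (\<lambda>c. smul c N)"
    using rad_smul[OF N_rad] by blast
  then have "parabolic_space \<chi> m V \<Theta> N"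
    using N_rad N1 m V_def by unfold_locales (auto simp: rad_def)
  then show ?thesis unfolding V_def by blast
qed

context parabolic_space
begin

definition hyp :: "'f vec set \<Rightarrow> bool" where
  "hyp H \<longleftrightarrow> subspace_dim (2 * m + 1) H (2 * m) \<and> N \<notin> H"

lemma N_nonzero: "N \<noteq> 0"
  using Theta_N Theta_zero by auto

lemma polar_N: "x \<in> V \<Longrightarrow> polar \<Theta> N x = 0" "x \<in> V \<Longrightarrow> polar \<Theta> x N = 0"
proof -
  have "N \<in> rad \<Theta> V" unfolding rad_N by (metis rangeI smul_simps(2))
  then show "x \<in> V \<Longrightarrow> polar \<Theta> N x = 0" "x \<in> V \<Longrightarrow> polar \<Theta> x N = 0"
    by (auto simp: rad_def polar_sym[of x])
qed

lemma subspace_dim_closed: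
  assumes "subspace_dim (2 * m + 1) H k"
  shows "H \<subseteq> V" "0 \<in> H" "x \<in> H \<Longrightarrow> y \<in> H \<Longrightarrow> x + y \<in> H" "x \<in> H \<Longrightarrow> smul a x \<in> H"
    "card H = CARD('f) ^ k"
proof -
  obtain vs where vs: "\<forall>j<k. vs j \<in> V" "lin_indep k vs" "H = span_of k vs"
    using assms unfolding subspace_dim_def V_eq by blast
  show "H \<subseteq> V" unfolding vs(3)
    using vs(1) by (intro span_subset W_zero W_add W_smul) auto
  show "0 \<in> H" "x \<in> H \<Longrightarrow> y \<in> H \<Longrightarrow> x + y \<in> H" "x \<in> H \<Longrightarrow> smul a x \<in> H"
    "card H = CARD('f) ^ k"
    by (simp_all add: vs(3) span_zero span_add span_smul card_span[OF vs(2)])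
qed

lemmas hyp_closed = subspace_dim_closed[of _ "2 * m", OF conjunct1[OF hyp_def[THEN iffD1]]]

lemma hyp_N: "hyp H \<Longrightarrow> N \<notin> H"
  by (simp add: hyp_def)

lemma smul_N_mem: "smul a N \<in> V"
  using N_mem W_smul by blast

lemma hyp_decomp_unique:
  assumes H: "hyp H" and xy: "x \<in> H" "y \<in> H" "x + smul a N = y + smul b N"
  shows "x = y \<and> a = b"
proof -
  have eq: "x + y = smul (a + b) N"
  proof
    fix i
    have "x i + a * N i = y i + b * N i"
      using fun_cong[OF xy(3), of i] by (simp add: smul_def)
    then have "(x i + a * N i) + (y i + b * N i) = 0"
      by (simp only: add_self)
    then have "(x i + y i) + (a * N i + b * N i) = 0"
      by (simp only: add_ac)
    then show "(x + y) i = smul (a + b) N i"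
      by (simp only: add_eq_zero smul_def plus_fun_def distrib_right)
  qed
  have "a + b = 0"
  proof (rule ccontr)
    assume ab: "a + b \<noteq> 0"
    have "x + y \<in> H" using hyp_closed(3)[OF H] xy by simp
    then have "smul (inverse (a + b)) (smul (a + b) N) \<in> H"
      unfolding eq by (rule hyp_closed(4)[OF H])
    then have "N \<in> H" using ab by (simp only: smul_simps(2,3) left_inverse not_False_eq_True)
    then show False using hyp_N[OF H] by simp
  qed
  then show ?thesis
    using eq by (simp add: smul_simps vec_add_eq_zero add_eq_zero)
qed

text \<open>Sums of a vector of \<open>H\<close> and a multiple of \<open>N\<close> are pairwise
  distinct, and there are as many of them as vectors in \<open>V\<close>.\<close>

lemma hyp_decomp:
  assumes H: "hyp H" and v: "v \<in> V"
  shows "\<exists>t. v + smul t N \<in> H"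
proof -
  have HV: "H \<subseteq> V" and cH: "card H = CARD('f) ^ (2 * m)"
    using hyp_closed[OF H] by blast+
  let ?g = "\<lambda>(h, t). h + smul t N"
  have inj: "inj_on ?g (H \<times> UNIV)"
    using hyp_decomp_unique[OF H] by (auto simp: inj_on_def)
  have "?g ` (H \<times> UNIV) = V"
  proof (rule card_subset_eq[OF W_fin])
    show "?g ` (H \<times> UNIV) \<subseteq> V"
      using HV smul_N_mem W_add by auto
    show "card (?g ` (H \<times> UNIV)) = card V"
      using card_image[OF inj] by (simp add: card_cartesian_product cH V_eq card_vecs)
  qed
  then obtain h t where ht: "h \<in> H" "v = h + smul t N" using v by force
  have "v + smul t N = h + (smul t N + smul t N)"
    by (simp only: ht add.assoc)
  then have "v + smul t N = h"
    by (simp only: vec_add_self add_0_right)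
  then show ?thesis using ht by metis
qed

text \<open>\<open>N\<close> is orthogonal to everything, so a vector orthogonal to \<open>H\<close>
  is orthogonal to \<open>V\<close> and lies on the line of \<open>N\<close>, which meets
  \<open>H\<close> only in 0.\<close>

lemma hyp_nondeg: "hyp H \<Longrightarrow> nondeg_space \<chi> H \<Theta>"
proof -
  assume H: "hyp H"
  note HV = hyp_closed(1)[OF H]
  interpret Q: quadratic_space \<chi> H \<Theta>
    using hyp_closed[OF H] by (intro subspace)
  have "x = 0" if x: "x \<in> H" "\<And>y. y \<in> H \<Longrightarrow> polar \<Theta> x y = 0" for x
  proof -
    have "polar \<Theta> x v = 0" if v: "v \<in> V" for v
    proof -
      obtain t where "v + smul t N \<in> H" using hyp_decomp[OF H v] by blast
      then have "polar \<Theta> x (v + smul t N) = 0" by (rule x(2))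
      then show ?thesis
        using x(1) HV v smul_N_mem N_mem
        by (simp add: polar_add_right polar_smul_right polar_N subset_iff)
    qed
    then have "x \<in> rad \<Theta> V" using x HV by (auto simp: rad_def)
    then obtain t where "x = smul t N" unfolding rad_N by blast
    then have "x + smul 0 N = 0 + smul t N" by (simp add: smul_simps)
    then show "x = 0" using hyp_decomp_unique[OF H x(1) Q.W_zero] by blast
  qed
  then show ?thesis
    by unfold_locales (auto simp: nondeg_def rad_def vzero_eq Q.W_zero Q.polar_zero)
qed

text \<open>Makes the type of a hyperplane readable from its Gauss sum, by
  \<open>witt_index_gauss_sum\<close>, which \<open>hyp_nondeg\<close> makes applicable.\<close>

lemma NO_odd_V_eq:
  "NO_odd_V m \<Theta> s = {H. hyp H \<and> sum sq H = (if s then int CARD('f) ^ m else - (int CARD('f) ^ m))}"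
proof -
  have "\<not> rad \<Theta> V \<subseteq> H \<longleftrightarrow> N \<notin> H" if H: "subspace_dim (2 * m + 1) H (2 * m)" for H
  proof -
    have "N \<in> rad \<Theta> V" unfolding rad_N by (metis rangeI smul_simps(2))
    then show ?thesis
      using subspace_dim_closed(4)[OF H, of N] unfolding rad_N by blast
  qed
  then have 1: "NO_odd_V m \<Theta> s = {H. hyp H \<and> nondeg \<Theta> H \<and> witt_index \<Theta> H = (if s then m else m - 1)}"
    unfolding NO_odd_V_def hyp_def V_eq by blast
  have "nondeg \<Theta> H \<and> witt_index \<Theta> H = (if s then m else m - 1) \<longleftrightarrow>
    sum sq H = (if s then int CARD('f) ^ m else - (int CARD('f) ^ m))" if H: "hyp H" for H
  proof -
    interpret Q: nondeg_space \<chi> H \<Theta> by (rule hyp_nondeg[OF H])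
    show ?thesis
      using Q.witt_index_gauss_sum(2)[OF hyp_closed(5)[OF H] m, of s] Q.W_nondeg by simp
  qed
  then show ?thesis unfolding 1 by blast
qed

lemma hyp_exists: "\<exists>H. hyp H"
proof -
  obtain i where i: "N i \<noteq> 0" using N_nonzero by (auto simp: fun_eq_iff)
  \<comment> \<open>The hyperplane is the one where coordinate \<open>i\<close> vanishes;
    \<open>\<sigma>\<close> enumerates the other coordinates by skipping \<open>i\<close>.\<close>
  define \<sigma> where "\<sigma> j = (if j < i then j else Suc j)" for j
  have \<sigma>: "\<sigma> j \<noteq> i" "\<sigma> j = \<sigma> k \<longleftrightarrow> j = k" for j k
    by (auto simp: \<sigma>_def)
  define vs :: "nat \<Rightarrow> 'f vec" where "vs j = (\<lambda>k. if k = \<sigma> j then 1 else 0)" for j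
  have l\<sigma>: "lincomb (2 * m) c vs (\<sigma> j) = c j" if "j < 2 * m" for c j
  proof -
    have "lincomb (2 * m) c vs (\<sigma> j) = (\<Sum>k<2 * m. if j = k then c k else 0)"
      unfolding lincomb_def by (intro sum.cong) (auto simp: vs_def \<sigma>)
    then show ?thesis using that by simp
  qed
  have li: "lincomb (2 * m) c vs i = 0" for c
    using \<sigma>(1)[symmetric] by (simp add: lincomb_def vs_def)
  have "lin_indep (2 * m) vs"
    unfolding lin_indep_def using l\<sigma> by (metis vzero_def)
  moreover have "\<forall>j<2 * m. vs j \<in> V"
    by (auto simp: V_eq vecs_def vs_def \<sigma>_def)
  ultimately have "subspace_dim (2 * m + 1) (span_of (2 * m) vs) (2 * m)"
    unfolding subspace_dim_def V_eq by blast
  moreover have "N \<notin> span_of (2 * m) vs"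
    using li i unfolding span_of_def by (metis rangeE)
  ultimately show ?thesis unfolding hyp_def by blast
qed

end

section \<open>Shears of a base hyperplane\<close>

locale parabolic_frame = parabolic_space +
  fixes H0 assumes H0: "hyp H0"

sublocale parabolic_frame \<subseteq> H0: nondeg_space \<chi> H0 \<Theta>
  by (rule hyp_nondeg[OF H0])

context parabolic_frame
begin

lemma H0_V: "x \<in> H0 \<Longrightarrow> x \<in> V"
  using hyp_closed(1)[OF H0] by blast

lemma card_H0: "card H0 = CARD('a) ^ (2 * m)"
  by (rule hyp_closed(5)[OF H0])

text \<open>The hyperplanes avoiding the nucleus are exactly the images of \<open>H0\<close> under these shears;
  pulled back to \<open>H0\<close>, they are all the quadratic forms with the same polar form as \<open>\<Theta>\<close>.\<close>

definition shear where "shear a x = x + smul (polar \<Theta> x a) N"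

definition sheared where "sheared a = shear a ` H0"

lemma shear_V: "x \<in> H0 \<Longrightarrow> shear a x \<in> V"
  unfolding shear_def by (intro W_add H0_V smul_N_mem)

lemma shear_add: "a \<in> H0 \<Longrightarrow> x \<in> H0 \<Longrightarrow> y \<in> H0 \<Longrightarrow> shear a (x + y) = shear a x + shear a y"
  by (simp add: shear_def H0.polar_add smul_simps add_ac)

lemma shear_smul: "a \<in> H0 \<Longrightarrow> x \<in> H0 \<Longrightarrow> shear a (smul c x) = smul c (shear a x)"
  by (simp add: shear_def H0.polar_smul smul_simps)

lemma shear_zero: "a \<in> H0 \<Longrightarrow> shear a 0 = 0"
  by (simp add: shear_def H0.polar_zero smul_simps)

lemma shear_eq: "x \<in> H0 \<Longrightarrow> y \<in> H0 \<Longrightarrow> shear a x = shear b y \<longleftrightarrow> x = y \<and> polar \<Theta> x a = polar \<Theta> x b"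
  unfolding shear_def using hyp_decomp_unique[OF H0, of x y "polar \<Theta> x a" "polar \<Theta> y b"] by auto

lemma Theta_shear:
  assumes "x \<in> H0"
  shows "\<Theta> (shear a x) = \<Theta> x + polar \<Theta> x a * polar \<Theta> x a"
  using assms by (simp add: shear_def Theta_add Theta_smul N_mem Theta_N polar_smul_right H0_V polar_N)

lemma polar_shear:
  assumes "x \<in> H0" "y \<in> H0"
  shows "polar \<Theta> (shear a x) (shear b y) = polar \<Theta> x y"
  using assms
  by (simp add: shear_def polar_add polar_add_right polar_smul polar_smul_right H0_V smul_N_mem N_mem
      W_add polar_N)

lemma shear_lincomb:
  assumes "a \<in> H0" "\<And>j. j < k \<Longrightarrow> vs j \<in> H0"
  shows "lincomb k c vs \<in> H0 \<and> lincomb k c (\<lambda>j. shear a (vs j)) = shear a (lincomb k c vs)"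
  using assms
  by (induction k) (simp_all add: lincomb_0 lincomb_Suc shear_zero shear_add shear_smul H0.W_zero H0.W_add H0.W_smul)

lemma H0_basis:
  obtains vs where "\<And>j. j < 2 * m \<Longrightarrow> vs j \<in> H0" "lin_indep (2 * m) vs" "H0 = span_of (2 * m) vs"
proof -
  obtain vs where vs: "lin_indep (2 * m) vs" "H0 = span_of (2 * m) vs"
    using H0 unfolding hyp_def subspace_dim_def by blast
  then show thesis using that[OF _ vs] span_base by blast
qed

lemma hyp_sheared:
  assumes a: "a \<in> H0"
  shows "hyp (sheared a)"
proof -
  obtain vs where vs: "\<And>j. j < 2 * m \<Longrightarrow> vs j \<in> H0" "lin_indep (2 * m) vs" "H0 = span_of (2 * m) vs"
    using H0_basis by blast
  define ws where "ws = (\<lambda>j. shear a (vs j))"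
  have lc: "lincomb (2 * m) c vs \<in> H0" "lincomb (2 * m) c ws = shear a (lincomb (2 * m) c vs)" for c
    unfolding ws_def using shear_lincomb[of a "2 * m" vs c] a vs(1) by auto
  have "span_of (2 * m) ws = sheared a"
    unfolding sheared_def by (subst vs(3)) (auto simp: span_of_def lc(2))
  moreover have "lin_indep (2 * m) ws"
    unfolding lin_indep_def
  proof (intro allI impI)
    fix c j assume c: "lincomb (2 * m) c ws = vzero" "j < 2 * m"
    then have "shear a (lincomb (2 * m) c vs) = shear a 0"
      using a by (simp add: lc vzero_eq shear_zero)
    then have "lincomb (2 * m) c vs = vzero"
      using lc(1) H0.W_zero by (simp add: shear_eq vzero_eq)
    then show "c j = 0" using vs(2) c(2) unfolding lin_indep_def by blast
  qed
  moreover have "\<forall>j<2 * m. ws j \<in> V"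
    using vs(1) shear_V by (simp add: ws_def)
  moreover have "N \<notin> sheared a"
  proof
    assume "N \<in> sheared a"
    then obtain x where x: "x \<in> H0" "N = shear a x" by (auto simp: sheared_def)
    then have "0 + smul 1 N = x + smul (polar \<Theta> x a) N" by (simp add: shear_def smul_simps)
    then have "0 = x \<and> 1 = polar \<Theta> x a"
      using hyp_decomp_unique[OF H0 H0.W_zero x(1)] by blast
    then show False using H0.polar_zero[OF a] by auto
  qed
  ultimately show ?thesis
    unfolding hyp_def subspace_dim_def V_eq by blast
qed

text \<open>Completing the square: the squared polar term added by the shear has the same sign as
  the polar term itself, so \<open>sq (shear a x) = sq a * sq (x + a)\<close>, and translation by
  \<open>a\<close> preserves the sum.\<close>

lemma sum_sheared:
  assumes a: "a \<in> H0"
  shows "sum sq (sheared a) = sq a * sum sq H0"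
proof -
  have "sum sq (sheared a) = (\<Sum>x\<in>H0. sq (shear a x))"
    unfolding sheared_def by (subst sum.reindex) (auto simp: inj_on_def shear_eq)
  also have "\<dots> = (\<Sum>x\<in>H0. sq a * sq (x + a))"
    using chi_sgn[of "\<Theta> a"]
    by (intro sum.cong refl) (auto simp: Theta_shear chi_add chi_square Theta_add)
  also have "\<dots> = sq a * (\<Sum>x\<in>H0. sq (x + a))"
    by (simp add: sum_distrib_left)
  also have "(\<Sum>x\<in>H0. sq (x + a)) = sum sq H0"
    using a H0.W_add by (intro sum.reindex_bij_betw H0.signed.bij_translate) auto
  finally show ?thesis .
qed

text \<open>Each basis vector of \<open>H0\<close> is moved into \<open>H\<close> by some multiple
  \<open>t j\<close> of \<open>N\<close>. A vector \<open>a\<close> with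
  \<open>polar \<Theta> (vs j) a = t j\<close> for all \<open>j\<close> gives a shear mapping
  \<open>H0\<close> into \<open>H\<close>, hence onto it by cardinality.\<close>

lemma sheared_surj:
  assumes H: "hyp H"
  shows "\<exists>a\<in>H0. H = sheared a"
proof -
  obtain vs where vs: "\<And>j. j < 2 * m \<Longrightarrow> vs j \<in> H0" "lin_indep (2 * m) vs" "H0 = span_of (2 * m) vs"
    using H0_basis by blast
  \<comment> \<open>\<open>g a\<close> lists the values of the functional given by \<open>a\<close>
    on the basis. It is injective by non-degeneracy, so by counting every list of values
    occurs.\<close>
  define g where "g a = (\<lambda>j. if j < 2 * m then polar \<Theta> (vs j) a else 0)" for a
  have "inj_on g H0"
  proof
    fix a b assume ab: "a \<in> H0" "b \<in> H0" "g a = g b"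
    have "polar \<Theta> (vs j) (a + b) = 0" if "j < 2 * m" for j
      using fun_cong[OF ab(3), of j] that ab vs(1) by (simp add: g_def H0.polar_add_right)
    then have "span_of (2 * m) vs \<subseteq> {x \<in> H0. polar \<Theta> x (a + b) = 0}"
      using vs(1) ab
      by (intro span_subset)
        (auto simp: H0.W_zero H0.W_add H0.W_smul H0.polar_zero H0.polar_add H0.polar_smul)
    then have "polar \<Theta> (a + b) x = 0" if "x \<in> H0" for x
      using that unfolding vs(3) by (auto simp: polar_sym[of "a + b"])
    then show "a = b"
      using H0.nondegD[of "a + b"] ab H0.W_add vec_add_eq_zero by blast
  qed
  then have "g ` H0 = vecs (2 * m)"
    by (intro card_subset_eq finite_vecs)
      (simp_all add: card_image card_H0 card_vecs, auto simp: g_def vecs_def)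
  moreover have "\<forall>j. \<exists>t. j < 2 * m \<longrightarrow> vs j + smul t N \<in> H"
    using hyp_decomp[OF H] vs(1) H0_V by blast
  then obtain t where t: "\<And>j. j < 2 * m \<Longrightarrow> vs j + smul (t j) N \<in> H" by metis
  have "(\<lambda>j. if j < 2 * m then t j else 0) \<in> vecs (2 * m)" by (simp add: vecs_def)
  ultimately have "(\<lambda>j. if j < 2 * m then t j else 0) \<in> g ` H0" by simp
  then obtain a where g_a: "(\<lambda>j. if j < 2 * m then t j else 0) = g a" and a: "a \<in> H0"
    by (rule imageE)
  have Ta: "shear a (vs j) \<in> H" if "j < 2 * m" for j
    using fun_cong[OF g_a, of j] t[OF that] that by (simp add: shear_def g_def)
  have "shear a x \<in> H" if x: "x \<in> H0" for x
  proof -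
    obtain c where c: "x = lincomb (2 * m) c vs" using x unfolding vs(3) by (auto simp: span_of_def)
    have "lincomb (2 * m) c (\<lambda>j. shear a (vs j)) \<in> H"
      using hyp_closed[OF H] Ta by (intro lincomb_in_subspace)
    then show ?thesis using shear_lincomb[of a "2 * m" vs c] a vs(1) c by simp
  qed
  then have sub: "sheared a \<subseteq> H" by (auto simp: sheared_def)
  have "card (sheared a) = card H"
    by (simp add: hyp_closed(5)[OF H] hyp_closed(5)[OF hyp_sheared[OF a]])
  moreover have "finite H" using hyp_nondeg[OF H] nondeg_space.axioms(1) quadratic_space.W_fin by blast
  ultimately have "sheared a = H" using sub card_subset_eq by blast
  then show ?thesis using a by blast
qed

lemma inj_sheared: "inj_on sheared H0"
proof
  fix a b assume ab: "a \<in> H0" "b \<in> H0" "sheared a = sheared b"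
  have "polar \<Theta> (a + b) x = 0" if x: "x \<in> H0" for x
  proof -
    have "shear a x \<in> sheared b" using x ab by (auto simp: sheared_def)
    then obtain y where "y \<in> H0" "shear a x = shear b y" by (auto simp: sheared_def)
    then have "polar \<Theta> x a = polar \<Theta> x b" using x by (metis shear_eq)
    then show ?thesis using x ab by (simp add: polar_sym[of "a + b"] H0.polar_add_right)
  qed
  then show "a = b"
    using H0.nondegD[of "a + b"] ab H0.W_add vec_add_eq_zero by blast
qed

lemma gauss_H0: "sum sq H0 \<noteq> 0"
proof
  assume "sum sq H0 = 0"
  then have "card H0 = 0" using H0.signed.gauss_sum_square by simp
  then show False by (simp add: card_H0)
qed

text \<open>By \<open>sum_sheared\<close> the Gauss sum changes sign exactly when
  \<open>sq a = -1\<close>; the non-vanishing of the sum over \<open>H0\<close> allows the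
  cancellation.\<close>

lemma bij_sheared: "bij_betw sheared {a \<in> H0. sq a = -1} {H. hyp H \<and> sum sq H = - sum sq H0}"
proof (rule bij_betw_imageI)
  show "inj_on sheared {a \<in> H0. sq a = -1}"
    using inj_sheared by (rule inj_on_subset) auto
  show "sheared ` {a \<in> H0. sq a = -1} = {H. hyp H \<and> sum sq H = - sum sq H0}"
  proof (intro equalityI subsetI)
    fix H assume "H \<in> {H. hyp H \<and> sum sq H = - sum sq H0}"
    then have H: "hyp H" "sum sq H = - sum sq H0" by auto
    obtain a where a: "a \<in> H0" "H = sheared a" using sheared_surj[OF H(1)] by blast
    then have "sq a * sum sq H0 = - sum sq H0" using sum_sheared H(2) by simp
    then have "sq a = -1" using chi_sgn[of "\<Theta> a"] gauss_H0 by auto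
    then show "H \<in> sheared ` {a \<in> H0. sq a = -1}" using a by blast
  qed (auto simp: hyp_sheared sum_sheared)
qed

text \<open>The two shears agree exactly on the vectors orthogonal to \<open>d = a + b\<close>. The
  radical of the intersection is the line through \<open>shear a d\<close>, and the displayed
  expression is the value of \<open>\<Theta>\<close> at that vector.\<close>

lemma adj_sheared:
  assumes a: "a \<in> H0" and b: "b \<in> H0" and ne: "a \<noteq> b"
  shows "NO_odd_adj \<Theta> (sheared a) (sheared b) \<longleftrightarrow>
    \<Theta> a + \<Theta> b + polar \<Theta> a b + polar \<Theta> a b * polar \<Theta> a b = 0"
proof -
  define d where "d = a + b"
  have d: "d \<in> H0" "d \<noteq> 0"
    using a b ne H0.W_add vec_add_eq_zero by (auto simp: d_def)
  have polar_d: "polar \<Theta> x d = 0 \<longleftrightarrow> polar \<Theta> x a = polar \<Theta> x b" if "x \<in> H0" for x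
    using that a b by (simp add: d_def H0.polar_add_right add_eq_zero)
  have da: "polar \<Theta> d a = polar \<Theta> a b"
    using a b by (simp add: d_def H0.polar_add H0.polar_self polar_sym[of b])
  have inter: "sheared a \<inter> sheared b = shear a ` {x \<in> H0. polar \<Theta> x d = 0}"
  proof (intro equalityI subsetI)
    fix v assume "v \<in> sheared a \<inter> sheared b"
    then obtain x y where xy: "x \<in> H0" "y \<in> H0" "v = shear a x" "shear a x = shear b y"
      by (auto simp: sheared_def)
    then show "v \<in> shear a ` {x \<in> H0. polar \<Theta> x d = 0}"
      using shear_eq[OF xy(1,2), of a b] polar_d by blast
  next
    fix v assume "v \<in> shear a ` {x \<in> H0. polar \<Theta> x d = 0}"
    then obtain x where x: "x \<in> H0" "polar \<Theta> x d = 0" "v = shear a x" by blast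
    then have "v = shear b x" using shear_eq[of x x a b] polar_d by simp
    then show "v \<in> sheared a \<inter> sheared b" using x(1,3) unfolding sheared_def by blast
  qed
  have dd: "polar \<Theta> d d = 0" using d H0.polar_self by blast
  have rad: "rad \<Theta> (sheared a \<inter> sheared b) = range (\<lambda>c. shear a (smul c d))"
  proof (intro equalityI subsetI)
    fix w assume "w \<in> rad \<Theta> (sheared a \<inter> sheared b)"
    then obtain x where x: "x \<in> H0" "polar \<Theta> x d = 0" "w = shear a x"
      and perp: "\<And>y. y \<in> H0 \<Longrightarrow> polar \<Theta> y d = 0 \<Longrightarrow> polar \<Theta> (shear a x) (shear a y) = 0"
      unfolding rad_def inter by blast
    obtain z where z: "z \<in> H0" "polar \<Theta> d z \<noteq> 0"
      using d H0.nondegD by blast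
    \<comment> \<open>Chosen so that \<open>x + smul c d\<close> is orthogonal to
      \<open>z\<close>.\<close>
    define c where "c = polar \<Theta> x z / polar \<Theta> d z"
    have "polar \<Theta> (x + smul c d) y = 0" if y: "y \<in> H0" for y
    proof -
      \<comment> \<open>Adding \<open>smul r z\<close> moves \<open>y\<close> into the vectors
        orthogonal to \<open>d\<close>, on which \<open>x\<close> is known to pair to 0.\<close>
      define r where "r = polar \<Theta> d y / polar \<Theta> d z"
      let ?y = "y + smul r z"
      have "polar \<Theta> d ?y = 0"
        using y z d by (simp add: H0.polar_add_right H0.polar_smul_right H0.W_smul r_def)
      then have "polar \<Theta> ?y d = 0" by (simp only: polar_sym[of ?y d])
      then have "polar \<Theta> x ?y = 0"
        using perp[of ?y] y z x(1) polar_shear[of x ?y] H0.W_add H0.W_smul by simp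
      then have "polar \<Theta> x y = r * polar \<Theta> x z"
        using y z x(1) by (simp add: H0.polar_add_right H0.polar_smul_right H0.W_smul add_eq_zero)
      then show ?thesis
        using x(1) d(1) y z(2)
        by (simp add: H0.polar_add H0.polar_smul H0.W_smul add_eq_zero c_def r_def)
    qed
    then have "x + smul c d = 0"
      using H0.nondegD[of "x + smul c d"] x(1) d(1) H0.W_add H0.W_smul by blast
    then show "w \<in> range (\<lambda>c. shear a (smul c d))"
      using x(3) by (simp add: vec_add_eq_zero)
  next
    fix w assume "w \<in> range (\<lambda>c. shear a (smul c d))"
    then obtain c where w: "w = shear a (smul c d)" by blast
    have cd: "smul c d \<in> {x \<in> H0. polar \<Theta> x d = 0}"
      using d dd by (simp add: H0.W_smul H0.polar_smul)
    have "polar \<Theta> (shear a (smul c d)) (shear a y) = 0" if y: "y \<in> H0" "polar \<Theta> y d = 0" for y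
    proof -
      have "polar \<Theta> d y = 0" using y(2) by (simp only: polar_sym[of d y])
      then show ?thesis using d y by (simp add: polar_shear H0.W_smul H0.polar_smul)
    qed
    then show "w \<in> rad \<Theta> (sheared a \<inter> sheared b)"
      unfolding rad_def inter w using cd by blast
  qed
  have Td: "shear a (smul c d) = 0 \<longleftrightarrow> c = 0" for c
    using shear_eq[of "smul c d" 0 a a] d a H0.W_smul H0.W_zero by (simp add: shear_zero smul_simps)
  have ThTd: "\<Theta> (shear a (smul c d)) = c * c * (\<Theta> a + \<Theta> b + polar \<Theta> a b + polar \<Theta> a b * polar \<Theta> a b)" for c
  proof -
    have "\<Theta> (shear a (smul c d)) = c * c * (\<Theta> d + polar \<Theta> d a * polar \<Theta> d a)"
      using d a by (simp add: Theta_shear H0.W_smul H0.Theta_smul H0.polar_smul algebra_simps)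
    also have "\<Theta> d = \<Theta> a + \<Theta> b + polar \<Theta> a b" unfolding d_def by (rule Theta_add)
    finally show ?thesis by (simp only: da)
  qed
  have "sheared a \<noteq> sheared b" using inj_sheared a b ne by (auto simp: inj_on_def)
  moreover have "singular \<Theta> (sheared a \<inter> sheared b) \<longleftrightarrow> (\<exists>c. c \<noteq> 0 \<and> \<Theta> (shear a (smul c d)) = 0)"
    unfolding singular_def rad vzero_eq using Td by blast
  moreover have "(\<exists>c. c \<noteq> 0 \<and> \<Theta> (shear a (smul c d)) = 0) \<longleftrightarrow>
      \<Theta> a + \<Theta> b + polar \<Theta> a b + polar \<Theta> a b * polar \<Theta> a b = 0"
    unfolding ThTd by (metis mult_eq_0_iff zero_neq_one)
  ultimately show ?thesis
    unfolding NO_odd_adj_def by blast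
qed

end

text \<open>Some shear by a vector of sign -1 turns either type into the other. Such a vector
  exists, since otherwise the Gauss sum would be the full cardinality
  \<open>CARD('f) ^ (2 * m)\<close>, which is too large.\<close>

lemma (in parabolic_space) hyp_of_type:
  "\<exists>H. hyp H \<and> sum sq H = (if s then int CARD('f) ^ m else - (int CARD('f) ^ m))"
proof -
  obtain H0 where H0: "hyp H0" using hyp_exists by blast
  interpret parabolic_frame \<chi> m V \<Theta> N H0
    by unfold_locales (rule H0)
  let ?p = "int CARD('f)"
  have p1: "?p > 1"
    using card_mono[of UNIV "{0, 1::'f}"] by simp
  have sum: "sum sq H0 = ?p ^ m \<or> sum sq H0 = - (?p ^ m)"
    by (rule H0.witt_index_gauss_sum(1)[OF card_H0 m])
  have "\<exists>a\<in>H0. sq a = -1"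
  proof (rule ccontr)
    assume "\<not> ?thesis"
    then have "sum sq H0 = (\<Sum>x\<in>H0. 1)"
      using chi_sgn by (intro sum.cong refl) blast
    then have "sum sq H0 = ?p ^ (2 * m)" by (simp add: card_H0)
    moreover have "?p ^ m < ?p ^ (2 * m)"
      using p1 m by (intro power_strict_increasing) auto
    moreover have "?p ^ m > 0" using p1 by simp
    ultimately show False using sum by linarith
  qed
  then obtain a where a: "a \<in> H0" "sq a = -1" by blast
  then have "hyp (sheared a)" "sum sq (sheared a) = - sum sq H0"
    by (simp_all add: hyp_sheared sum_sheared)
  then show ?thesis
    using H0 sum by (cases s) (metis minus_minus)+
qed

section \<open>Two-graphs and switching\<close>

text \<open>Nested equivalence of three truth values is parity: it holds exactly when an odd number
  of them are true.\<close>

lemma two_graph_triple: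
  assumes "x \<in> V" "y \<in> V" "z \<in> V" and ne: "x \<noteq> y" "x \<noteq> z" "y \<noteq> z"
    and sym: "E y x = E x y" "E z x = E x z" "E z y = E y z"
  shows "{x, y, z} \<in> snd (two_graph_of V E) \<longleftrightarrow> (E x y \<longleftrightarrow> (E x z \<longleftrightarrow> E y z))"
proof -
  let ?S = "{e. \<exists>u v. e = {u, v} \<and> u \<in> {x, y, z} \<and> v \<in> {x, y, z} \<and> u \<noteq> v \<and> E u v}"
  have S: "?S = (if E x y then {{x, y}} else {}) \<union> ((if E x z then {{x, z}} else {}) \<union>
    (if E y z then {{y, z}} else {}))" (is "_ = ?R")
  proof (intro equalityI subsetI)
    fix e assume "e \<in> ?S"
    then obtain u v where e: "e = {u, v}" "u \<in> {x, y, z}" "v \<in> {x, y, z}" "u \<noteq> v" "E u v"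
      by blast
    then show "e \<in> ?R"
      using sym by (auto simp: insert_commute)
  next
    fix e assume "e \<in> ?R"
    then consider "e = {x, y}" "E x y" | "e = {x, z}" "E x z" | "e = {y, z}" "E y z"
      by (auto split: if_splits)
    then show "e \<in> ?S"
      by cases (use ne in blast)+
  qed
  have d: "{x, y} \<noteq> {x, z}" "{x, y} \<noteq> {y, z}" "{x, z} \<noteq> {y, z}"
    using ne by (auto simp: doubleton_eq_iff)
  have "odd (card ?S) \<longleftrightarrow> (E x y \<longleftrightarrow> (E x z \<longleftrightarrow> E y z))"
    unfolding S using d by (cases "E x y"; cases "E x z"; cases "E y z") simp_all
  moreover have "card {x, y, z} = 3" using ne by simp
  ultimately show ?thesis
    using assms(1-3) by (simp add: two_graph_of_def)
qed

text \<open>Membership only asserts the equation for some enumeration of the triple; symmetry of the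
  polar form transfers it to the given one.\<close>

lemma X_tg_triple:
  fixes \<Phi> :: "('a::comm_semiring_1) vec \<Rightarrow> 'a"
  assumes "x \<in> fst (X_tg n \<Phi>)" "y \<in> fst (X_tg n \<Phi>)" "z \<in> fst (X_tg n \<Phi>)"
    and ne: "x \<noteq> y" "x \<noteq> z" "y \<noteq> z"
  shows "{x, y, z} \<in> snd (X_tg n \<Phi>) \<longleftrightarrow> polar \<Phi> x y + polar \<Phi> x z + polar \<Phi> y z = 0"
proof
  assume "{x, y, z} \<in> snd (X_tg n \<Phi>)"
  then obtain a b c where abc: "{x, y, z} = {a, b, c}" "a \<noteq> b" "a \<noteq> c" "b \<noteq> c"
    "polar \<Phi> a b + polar \<Phi> a c + polar \<Phi> b c = 0"
    by (auto simp: X_tg_def)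
  have sym: "polar \<Phi> u v = polar \<Phi> v u" for u v
    by (simp add: polar_def vadd_def add_ac)
  have x: "x \<in> {a, b, c}" "y \<in> {a, b, c}" "z \<in> {a, b, c}" using abc(1) by blast+
  then consider "x = a" "y = b" "z = c" | "x = a" "y = c" "z = b" | "x = b" "y = a" "z = c"
    | "x = b" "y = c" "z = a" | "x = c" "y = a" "z = b" | "x = c" "y = b" "z = a"
    using ne by blast
  then show "polar \<Phi> x y + polar \<Phi> x z + polar \<Phi> y z = 0"
    using abc(5) sym[of b a] sym[of c a] sym[of c b] by cases (simp_all add: add_ac)
next
  assume "polar \<Phi> x y + polar \<Phi> x z + polar \<Phi> y z = 0"
  moreover have "x \<in> vecs n" "y \<in> vecs n" "z \<in> vecs n" "\<Phi> x = 1" "\<Phi> y = 1" "\<Phi> z = 1"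
    using assms by (auto simp: X_tg_def)
  ultimately show "{x, y, z} \<in> snd (X_tg n \<Phi>)"
    unfolding X_tg_def snd_conv mem_Collect_eq using ne by (intro exI[of _ x] exI[of _ y] exI[of _ z] conjI refl)
qed

text \<open>Switching does not change the associated two-graph, so an arbitrary switching set
  \<open>Y\<close> is allowed; this serves both families of graphs.\<close>

lemma tg_iso_X_tg:
  fixes \<Phi> :: "('a::{field,finite}) vec \<Rightarrow> 'a"
  assumes two: "CARD('a) = 2"
    and p: "bij_betw p {a \<in> vecs n. \<Phi> a = 1} V"
    and E: "\<And>x y. x \<in> vecs n \<Longrightarrow> y \<in> vecs n \<Longrightarrow> \<Phi> x = 1 \<Longrightarrow> \<Phi> y = 1 \<Longrightarrow> x \<noteq> y \<Longrightarrow>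
      E (p x) (p y) \<longleftrightarrow> (polar \<Phi> x y = 0 \<longleftrightarrow> (x \<in> Y \<longleftrightarrow> y \<in> Y))"
  shows "tg_iso (two_graph_of V E) (X_tg n \<Phi>)"
proof -
  let ?A = "{a \<in> vecs n. \<Phi> a = 1}"
  have fstX: "fst (X_tg n \<Phi>) = ?A" and fst2: "fst (two_graph_of V E) = V"
    by (simp_all add: X_tg_def two_graph_of_def)
  have oneone: "(1::'a) + 1 = 0"
    using of_nat_card_field[where 'f = 'a] two by simp
  have sym: "polar \<Phi> u v = polar \<Phi> v u" for u v
    by (simp add: polar_def vadd_def add_ac)
  define f where "f = the_inv_into ?A p"
  have f: "bij_betw f V ?A" unfolding f_def by (rule bij_betw_the_inv_into[OF p])
  have pf: "p (f v) = v" if "v \<in> V" for v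
    unfolding f_def using f_the_inv_into_f_bij_betw[OF p] that by blast
  have "t \<in> snd (two_graph_of V E) \<longleftrightarrow> f ` t \<in> snd (X_tg n \<Phi>)" if t: "t \<subseteq> V" for t
  proof (cases "card t = 3")
    case True
    then obtain u v w where uvw: "t = {u, v, w}" "u \<noteq> v" "u \<noteq> w" "v \<noteq> w"
      by (metis card_3_iff)
    have V: "u \<in> V" "v \<in> V" "w \<in> V" using t uvw by auto
    have ff: "f u \<noteq> f v" "f u \<noteq> f w" "f v \<noteq> f w"
      using f V uvw by (auto simp: bij_betw_def inj_on_def)
    have fA: "f x \<in> ?A" if "x \<in> V" for x using f that by (rule bij_betw_apply)
    have EE: "E x y \<longleftrightarrow> (polar \<Phi> (f x) (f y) = 0 \<longleftrightarrow> (f x \<in> Y \<longleftrightarrow> f y \<in> Y))"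
      if "x \<in> V" "y \<in> V" "f x \<noteq> f y" for x y
      using E[of "f x" "f y"] fA[OF that(1)] fA[OF that(2)] that by (simp add: pf)
    have el: "r = 0 \<or> r = 1" for r :: 'a by (rule field2_elements[OF two])
    \<comment> \<open>Over the field of order 2, three elements sum to 0 exactly when an odd number
      of them are 0.\<close>
    have par: "a + b + c = 0 \<longleftrightarrow> (a = 0 \<longleftrightarrow> (b = 0 \<longleftrightarrow> c = 0))" for a b c :: 'a
      using el[of a] el[of b] el[of c] oneone by (elim disjE) simp_all
    have "t \<in> snd (two_graph_of V E) \<longleftrightarrow> (E u v \<longleftrightarrow> (E u w \<longleftrightarrow> E v w))"
      unfolding uvw(1) using V uvw ff
      by (intro two_graph_triple) (auto simp: EE sym[of "f v" "f u"] sym[of "f w" "f u"] sym[of "f w" "f v"])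
    also have "\<dots> \<longleftrightarrow> polar \<Phi> (f u) (f v) + polar \<Phi> (f u) (f w) + polar \<Phi> (f v) (f w) = 0"
      \<comment> \<open>Each vertex of the triangle lies on two of its edges, so the contributions
        of \<open>Y\<close> cancel.\<close>
      using V ff unfolding par by (simp add: EE) blast
    also have "\<dots> \<longleftrightarrow> f ` t \<in> snd (X_tg n \<Phi>)"
      unfolding uvw(1) image_insert image_empty
      by (rule X_tg_triple[symmetric]) (use ff fA V in \<open>simp_all add: fstX\<close>)
    finally show ?thesis .
  next
    case False
    have "card (f ` t) = card t"
      using f t by (intro card_image) (auto simp: bij_betw_def inj_on_def subset_iff)
    then have "card (f ` t) \<noteq> 3" using False by simp
    then have "f ` t \<notin> snd (X_tg n \<Phi>)" by (auto simp: X_tg_def)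
    then show ?thesis using False by (simp add: two_graph_of_def)
  qed
  then show ?thesis
    unfolding tg_iso_def fstX fst2 using f by blast
qed

section \<open>Tangent lines over the field of order 2\<close>

context
  fixes \<Theta> :: "('a::{field,finite}) vec \<Rightarrow> 'a" and n :: nat
  assumes two: "CARD('a) = 2" and qf: "is_qform n \<Theta>"
begin

interpretation quadratic_space chi2 "vecs n" \<Theta>
  by (rule char2_character.quadratic_space_vecs[OF chi2_character[OF two] qf])

lemma pt_eq: "pt (a::'a vec) = {0, a}"
proof -
  have U: "(UNIV :: 'a set) = {0, 1}" using field2_elements[OF two] by blast
  show ?thesis unfolding pt_def U by (simp add: smul_simps)
qed

lemma bij_pt: "bij_betw pt {a \<in> vecs n. \<Theta> a = 1} (NO_even_V n \<Theta>)"
proof (rule bij_betw_imageI)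
  have "a \<noteq> 0" if "\<Theta> a = 1" for a using that Theta_zero by auto
  then show "inj_on pt {a \<in> vecs n. \<Theta> a = 1}"
    by (auto simp: inj_on_def pt_eq doubleton_eq_iff)
  have "\<Theta> a \<noteq> 0 \<longleftrightarrow> \<Theta> a = 1" for a
    using field2_elements[OF two, of "\<Theta> a"] by auto
  then show "pt ` {a \<in> vecs n. \<Theta> a = 1} = NO_even_V n \<Theta>"
    using Theta_zero by (auto simp: NO_even_V_def vzero_eq)
qed

lemma line_eq: "line a b = {0, a, b, a + b :: 'a vec}"
proof -
  have U: "(UNIV :: 'a set) = {0, 1}" using field2_elements[OF two] by blast
  have l: "lincomb 2 c (\<lambda>j. if j = 0 then a else b) = smul (c 0) a + smul (c 1) b" for c
    by (rule ext) (simp add: lincomb_def smul_def numeral_2_eq_2)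
  have "line a b = (\<lambda>(s, t). smul s a + smul t b) ` (UNIV \<times> UNIV)"
  proof (intro equalityI subsetI)
    fix x assume "x \<in> line a b"
    then show "x \<in> (\<lambda>(s, t). smul s a + smul t b) ` (UNIV \<times> UNIV)"
      by (auto simp: line_def span_of_def l)
  next
    fix x assume "x \<in> (\<lambda>(s, t). smul s a + smul t b) ` (UNIV \<times> UNIV)"
    then obtain s t where "x = smul s a + smul t b" by auto
    then have "x = lincomb 2 (\<lambda>j. if j = 0 then s else t) (\<lambda>j. if j = 0 then a else b)"
      by (simp add: l)
    then show "x \<in> line a b" unfolding line_def span_of_def by blast
  qed
  then show ?thesis unfolding U by (auto simp: smul_simps)
qed

text \<open>The third point \<open>a + b\<close> of the line is the only one that can lie on the
  quadric, and \<open>\<Theta> (a + b) = 1 + 1 + polar \<Theta> a b\<close>.\<close>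

lemma NO_even_adj_iff:
  assumes a: "a \<in> vecs n" "\<Theta> a = 1" and b: "b \<in> vecs n" "\<Theta> b = 1" and ne: "a \<noteq> b"
  shows "NO_even_adj \<Theta> (pt a) (pt b) \<longleftrightarrow> polar \<Theta> a b = 0"
proof -
  have nz: "a \<noteq> 0" "b \<noteq> 0" using a b Theta_zero by auto
  have ab: "a + b \<noteq> 0" using ne by (simp add: vec_add_eq_zero)
  have pt_inj: "pt x = pt y \<longleftrightarrow> x = y" for x y :: "'a vec"
    by (auto simp: pt_eq doubleton_eq_iff)
  have Th: "\<Theta> (a + b) = polar \<Theta> a b"
    by (simp add: Theta_add a b)
  have pts: "{P. \<exists>c\<in>line a b. c \<noteq> vzero \<and> \<Theta> c = 0 \<and> P = pt c} =
      (if polar \<Theta> a b = 0 then {pt (a + b)} else {})"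
    unfolding line_eq vzero_eq using ab a b Th by auto
  have "\<not> (\<forall>c\<in>line a b. \<Theta> c = 0)"
    unfolding line_eq using a by auto
  then have "tangent \<Theta> (line a b) \<longleftrightarrow> polar \<Theta> a b = 0"
    unfolding tangent_def pts by simp
  then show ?thesis
    unfolding NO_even_adj_def pt_inj using ne by auto
qed

end

section \<open>Comparison of the graphs with the symplectic two-graphs\<close>

lemma form_type_gauss_sum:
  fixes \<Phi> :: "('a::{field,finite}) vec \<Rightarrow> 'a"
  assumes two: "CARD('a) = 2" and \<Phi>: "form_type (2 * m) \<Phi> s" and m: "m \<ge> 1"
  shows "nondeg_space chi2 (vecs (2 * m)) \<Phi>"
    and "(\<Sum>x\<in>vecs (2 * m). chi2 (\<Phi> x)) = (if s then 2 ^ m else - (2 ^ m))"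
proof -
  interpret quadratic_space chi2 "vecs (2 * m)" \<Phi>
    using char2_character.quadratic_space_vecs[OF chi2_character[OF two]] \<Phi>
    by (simp add: form_type_def)
  show nd: "nondeg_space chi2 (vecs (2 * m)) \<Phi>"
    using \<Phi> by unfold_locales (simp add: form_type_def)
  have w: "witt_index \<Phi> (vecs (2 * m)) = (if s then m else m - 1)"
    using \<Phi> by (simp add: form_type_def)
  show "(\<Sum>x\<in>vecs (2 * m). chi2 (\<Phi> x)) = (if s then 2 ^ m else - (2 ^ m))"
    using nondeg_space.witt_index_gauss_sum(2)[OF nd card_vecs m, of s, THEN iffD1, OF w]
    by (simp add: two)
qed

lemma chi2_iff:
  assumes "CARD('a::{field,finite}) = 2"
  shows "chi2 (x::'a) = 1 \<longleftrightarrow> x = 0" "chi2 x = -1 \<longleftrightarrow> x = 1"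
  using field2_elements[OF assms, of x] by (auto simp: chi2_def)

text \<open>Two forms of the same type have equal Gauss sums, so they are isometric. Under the
  isometry tangency is orthogonality, with no switching: \<open>Y = {}\<close>.\<close>

lemma NO_even_two_graph:
  fixes \<Theta> \<Phi> :: "('a::{field,finite}) vec \<Rightarrow> 'a"
  assumes two: "CARD('a) = 2" and m: "m \<ge> 1"
    and \<Theta>: "form_type (2 * m) \<Theta> s" and \<Phi>: "form_type (2 * m) \<Phi> s"
  shows "tg_iso (two_graph_of (NO_even_V (2 * m) \<Theta>) (NO_even_adj \<Theta>)) (X_tg (2 * m) \<Phi>)"
proof -
  interpret T: nondeg_space chi2 "vecs (2 * m)" \<Theta> by (rule form_type_gauss_sum[OF two \<Theta> m])
  interpret P: nondeg_space chi2 "vecs (2 * m)" \<Phi> by (rule form_type_gauss_sum[OF two \<Phi> m])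
  have qf: "is_qform (2 * m) \<Theta>" using \<Theta> by (simp add: form_type_def)
  have "sum P.sq (vecs (2 * m)) = sum T.sq (vecs (2 * m))"
    by (simp only: form_type_gauss_sum(2)[OF two \<Theta> m] form_type_gauss_sum(2)[OF two \<Phi> m])
  then obtain g where
    "bij_betw g {x \<in> vecs (2 * m). P.sq x = -1} {x \<in> vecs (2 * m). T.sq x = -1}"
    and pol_g: "\<forall>x\<in>vecs (2 * m). \<forall>y\<in>vecs (2 * m). sign_polar T.sq (g x) (g y) = sign_polar P.sq x y"
    using signed_form_isometry_minus[OF P.signed.signed_form_axioms T.signed.signed_form_axioms refl]
    by blast
  then have g: "bij_betw g {x \<in> vecs (2 * m). \<Phi> x = 1} {x \<in> vecs (2 * m). \<Theta> x = 1}"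
    by (simp only: chi2_iff[OF two])
  have pol: "polar \<Theta> (g x) (g y) = 0 \<longleftrightarrow> polar \<Phi> x y = 0"
    if "x \<in> vecs (2 * m)" "y \<in> vecs (2 * m)" for x y
    using pol_g that by (simp add: T.pol_sq P.pol_sq flip: chi2_iff(1)[OF two])
  have gx: "g x \<in> vecs (2 * m) \<and> \<Theta> (g x) = 1" if "x \<in> vecs (2 * m)" "\<Phi> x = 1" for x
    using bij_betw_apply[OF g] that by blast
  have "g x \<noteq> g y" if "x \<in> vecs (2 * m)" "\<Phi> x = 1" "y \<in> vecs (2 * m)" "\<Phi> y = 1" "x \<noteq> y" for x y
    using g that by (auto simp: bij_betw_def inj_on_def)
  then show ?thesis
    using bij_betw_trans[OF g bij_pt[OF two qf]] gx pol
    by (intro tg_iso_X_tg[OF two, where p = "pt \<circ> g" and Y = "{}"])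
      (simp_all add: NO_even_adj_iff[OF two qf])
qed

text \<open>In the field with four elements \<open>b + b\<^sup>2\<close> is the trace of \<open>b\<close>, and two elements of
  trace 1 differ by 0 or 1; hence the adjacency criterion below is a switching of the
  trace form.\<close>

lemma field4_adj:
  fixes u v b w :: "'b::{field,finite}"
  assumes four: "CARD('b) = 4" and w: "w \<noteq> 0" "w \<noteq> 1"
    and u: "chi4 u = -1" and v: "chi4 v = -1"
  shows "u + v + b + b * b = 0 \<longleftrightarrow> (chi4 b = 1 \<longleftrightarrow> (u = w \<longleftrightarrow> v = w))"
proof -
  note el = field4_elements[OF four w]
  have two: "(2::'b) = 0" by (rule field4_two[OF four])
  have aa: "x + (x + y) = y" for x y :: 'b
    using two by (metis add.assoc add_0 mult_2 mult_zero_left)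
  have self: "x + x = 0" for x :: 'b
    using aa[of x 0] by simp
  have u': "u = w \<or> u = w + 1" and v': "v = w \<or> v = w + 1"
    using el(1)[of u] el(1)[of v] u v by (auto simp: chi4_def split: if_splits)
  have ww: "(w + 1) * (w + 1) = w"
    using el(2) by (simp add: algebra_simps aa self)
  have w1: "w + 1 \<noteq> w" by simp
  have bb: "b + b * b = (if chi4 b = 1 then 0 else 1)"
    using el(1)[of b] by (elim disjE) (use w el(2-4) in \<open>simp_all only: chi4_def ww\<close>, simp_all add: aa self two add_ac)
  have uv: "u + v = (if u = w \<longleftrightarrow> v = w then 0 else 1)"
    using u' v' by (elim disjE) (simp_all add: aa self two add_ac)
  have "u + v + b + b * b = (if u = w \<longleftrightarrow> v = w then 0 else 1) + (if chi4 b = 1 then 0 else 1)"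
    unfolding uv[symmetric] bb[symmetric] by (simp only: add.assoc)
  then show ?thesis using self[of 1] by auto
qed

text \<open>Common source of the second and third claims. The binary space of dimension
  \<open>4 * m\<close> and a hyperplane of type \<open>s\<close> over the field of order 4 both have
  \<open>16 ^ m\<close> vectors and Gauss sum \<open>4 ^ m\<close> up to the common sign, so their
  sign forms are isometric.\<close>

lemma NO_odd_switching:
  fixes \<Phi> :: "('a::{field,finite}) vec \<Rightarrow> 'a" and \<Theta> :: "('b::{field,finite}) vec \<Rightarrow> 'b"
  assumes two: "CARD('a) = 2" and four: "CARD('b) = 4" and m: "m \<ge> 1"
    and \<Phi>: "form_type (4 * m) \<Phi> s" and \<Theta>: "parabolic m \<Theta>"
  shows "\<exists>p Y. bij_betw p {a \<in> vecs (4 * m). \<Phi> a = 1} (NO_odd_V m \<Theta> (\<not> s)) \<and>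
    (\<forall>x y. x \<in> vecs (4 * m) \<longrightarrow> y \<in> vecs (4 * m) \<longrightarrow> \<Phi> x = 1 \<longrightarrow> \<Phi> y = 1 \<longrightarrow> x \<noteq> y \<longrightarrow>
      NO_odd_adj \<Theta> (p x) (p y) = (polar \<Phi> x y = 0 \<longleftrightarrow> (x \<in> Y \<longleftrightarrow> y \<in> Y)))"
proof -
  have mm: "4 * m = 2 * (2 * m)" and m2: "2 * m \<ge> 1" using m by simp_all
  have \<Phi>2: "form_type (2 * (2 * m)) \<Phi> s" using \<Phi> by (simp only: mm)
  interpret P: nondeg_space chi2 "vecs (4 * m)" \<Phi>
    unfolding mm by (rule form_type_gauss_sum[OF two \<Phi>2 m2])
  interpret F: char2_character "chi4 :: 'b \<Rightarrow> int" by (rule chi4_character[OF four])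
  obtain N where "parabolic_space chi4 m (vecs (2 * m + 1)) \<Theta> N"
    using F.parabolic_spaceI[OF \<Theta> m] by blast
  then interpret T: parabolic_space chi4 m "vecs (2 * m + 1)" \<Theta> N .
  \<comment> \<open>The base hyperplane has type \<open>s\<close>, so that vectors of sign -1
    parametrize the hyperplanes of the opposite type.\<close>
  obtain H0 where H0: "T.hyp H0"
    and sum: "sum T.sq H0 = (if s then int CARD('b) ^ m else - (int CARD('b) ^ m))"
    using T.hyp_of_type by blast
  interpret T: parabolic_frame chi4 m "vecs (2 * m + 1)" \<Theta> N H0
    by unfold_locales (rule H0)
  have "card (vecs (4 * m) :: 'a vec set) = card H0"
  proof -
    have "(2::nat) ^ (4 * m) = (2 ^ 2) ^ (2 * m)" by (simp only: power_mult[symmetric]) simp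
    then show ?thesis by (simp add: T.card_H0 card_vecs two four)
  qed
  moreover have "sum P.sq (vecs (4 * m)) = sum T.sq H0"
    using form_type_gauss_sum(2)[OF two \<Phi>2 m2] unfolding sum mm four
    by (simp add: power_mult)
  ultimately obtain g where
    g: "bij_betw g {x \<in> vecs (4 * m). P.sq x = -1} {x \<in> H0. T.sq x = -1}"
    and pol: "\<forall>x\<in>vecs (4 * m). \<forall>y\<in>vecs (4 * m). sign_polar T.sq (g x) (g y) = sign_polar P.sq x y"
    using signed_form_isometry_minus[OF P.signed.signed_form_axioms T.H0.signed.signed_form_axioms]
    by blast
  have A: "{x \<in> vecs (4 * m). P.sq x = -1} = {x \<in> vecs (4 * m). \<Phi> x = 1}"
    by (simp add: chi2_iff[OF two])
  have img: "{H. T.hyp H \<and> sum T.sq H = - sum T.sq H0} = NO_odd_V m \<Theta> (\<not> s)"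
    unfolding T.NO_odd_V_eq sum by (cases s) simp_all
  have bij: "bij_betw (T.sheared \<circ> g) {x \<in> vecs (4 * m). \<Phi> x = 1} (NO_odd_V m \<Theta> (\<not> s))"
    using bij_betw_trans[OF g T.bij_sheared] unfolding A img .
  obtain w where "chi4 (w::'b) = -1" using F.chi_nontrivial by blast
  then have w: "w \<noteq> 0" "w \<noteq> 1" by (auto simp: chi4_def)
  \<comment> \<open>\<open>w\<close> is one of the two elements of trace 1; its fibre is the
    switching set.\<close>
  define Y where "Y = {x. \<Theta> (g x) = w}"
  have "NO_odd_adj \<Theta> (T.sheared (g x)) (T.sheared (g y)) = (polar \<Phi> x y = 0 \<longleftrightarrow> (x \<in> Y \<longleftrightarrow> y \<in> Y))"
    if x: "x \<in> vecs (4 * m)" "\<Phi> x = 1" and y: "y \<in> vecs (4 * m)" "\<Phi> y = 1" and ne: "x \<noteq> y" for x y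
  proof -
    have gx: "g x \<in> H0" "T.sq (g x) = -1" and gy: "g y \<in> H0" "T.sq (g y) = -1"
      using bij_betw_apply[OF g, unfolded A] x y by auto
    have gne: "g x \<noteq> g y"
      using g x y ne unfolding A by (auto simp: bij_betw_def inj_on_def)
    have "chi4 (polar \<Theta> (g x) (g y)) = 1 \<longleftrightarrow> polar \<Phi> x y = 0"
      using pol x y by (simp add: T.pol_sq P.pol_sq chi2_iff[OF two])
    then show ?thesis
      unfolding T.adj_sheared[OF gx(1) gy(1) gne] field4_adj[OF four w gx(2) gy(2)]
      by (simp add: Y_def)
  qed
  then show ?thesis using bij by (intro exI[of _ "T.sheared \<circ> g"] exI[of _ Y]) auto
qed

text \<open>Both graphs are labelled by the same set \<open>A\<close>; the bijection is
  \<open>h\<close> after the inverse of \<open>p\<close>, and \<open>Y\<close> is transported along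
  \<open>p\<close>.\<close>

lemma switching_equivI:
  assumes p: "bij_betw p A V1" and h: "bij_betw h A V2"
    and E: "\<And>x y. x \<in> A \<Longrightarrow> y \<in> A \<Longrightarrow> x \<noteq> y \<Longrightarrow>
      E2 (h x) (h y) \<longleftrightarrow> (E1 (p x) (p y) \<longleftrightarrow> (x \<in> Y \<longleftrightarrow> y \<in> Y))"
  shows "switching_equiv V1 E1 V2 E2"
proof -
  define k where "k = the_inv_into A p"
  have k: "bij_betw k V1 A" unfolding k_def by (rule bij_betw_the_inv_into[OF p])
  have pk: "p (k v) = v" if "v \<in> V1" for v
    unfolding k_def using f_the_inv_into_f_bij_betw[OF p] that by blast
  have kA: "k v \<in> A" if "v \<in> V1" for v using k that by (rule bij_betw_apply)
  have "E2 ((h \<circ> k) u) ((h \<circ> k) v) \<longleftrightarrow>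
      (E1 u v \<longleftrightarrow> (u \<in> {v \<in> V1. k v \<in> Y} \<longleftrightarrow> v \<in> {v \<in> V1. k v \<in> Y}))"
    if "u \<in> V1" "v \<in> V1" "u \<noteq> v" for u v
  proof -
    have "k u \<noteq> k v" using that pk by metis
    then show ?thesis
      using E[OF kA[OF that(1)] kA[OF that(2)]] that by (simp add: pk)
  qed
  then show ?thesis
    unfolding switching_equiv_def using bij_betw_trans[OF k h]
    by (intro exI[of _ "h \<circ> k"] exI[of _ "{v \<in> V1. k v \<in> Y}"]) blast
qed

theorem theorem4p7:
  fixes m :: nat and s :: bool
  assumes "m \<ge> 1"
    and "CARD('a) = 2"
    and "CARD('b) = 4"
  shows
    "(\<forall>(\<Theta>::('a::{field,finite}) vec \<Rightarrow> 'a) (\<Phi>::'a vec \<Rightarrow> 'a).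
        form_type (2*m) \<Theta> s \<and> form_type (2*m) \<Phi> s \<longrightarrow>
        tg_iso (two_graph_of (NO_even_V (2*m) \<Theta>) (NO_even_adj \<Theta>)) (X_tg (2*m) \<Phi>))
   \<and> (\<forall>(\<Theta>::('b::{field,finite}) vec \<Rightarrow> 'b) (\<Phi>::'a vec \<Rightarrow> 'a).
        parabolic m \<Theta> \<and> form_type (4*m) \<Phi> s \<longrightarrow>
        tg_iso (two_graph_of (NO_odd_V m \<Theta> (\<not> s)) (NO_odd_adj \<Theta>)) (X_tg (4*m) \<Phi>))
   \<and> (\<forall>(\<Theta>::'a vec \<Rightarrow> 'a) (\<Psi>::'b vec \<Rightarrow> 'b).
        form_type (4*m) \<Theta> s \<and> parabolic m \<Psi> \<longrightarrow>
        switching_equiv (NO_even_V (4*m) \<Theta>) (NO_even_adj \<Theta>)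
                        (NO_odd_V m \<Psi> (\<not> s)) (NO_odd_adj \<Psi>))"
proof (intro conjI allI impI; elim conjE)
  fix \<Theta> \<Phi> :: "'a vec \<Rightarrow> 'a"
  assume "form_type (2*m) \<Theta> s" "form_type (2*m) \<Phi> s"
  then show "tg_iso (two_graph_of (NO_even_V (2*m) \<Theta>) (NO_even_adj \<Theta>)) (X_tg (2*m) \<Phi>)"
    by (rule NO_even_two_graph[OF assms(2,1)])
next
  fix \<Theta> :: "'b vec \<Rightarrow> 'b" and \<Phi> :: "'a vec \<Rightarrow> 'a"
  assume "parabolic m \<Theta>" "form_type (4*m) \<Phi> s"
  then obtain p Y where p: "bij_betw p {a \<in> vecs (4 * m). \<Phi> a = 1} (NO_odd_V m \<Theta> (\<not> s))"
    "\<forall>x y. x \<in> vecs (4 * m) \<longrightarrow> y \<in> vecs (4 * m) \<longrightarrow> \<Phi> x = 1 \<longrightarrow> \<Phi> y = 1 \<longrightarrow> x \<noteq> y \<longrightarrow>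
      NO_odd_adj \<Theta> (p x) (p y) = (polar \<Phi> x y = 0 \<longleftrightarrow> (x \<in> Y \<longleftrightarrow> y \<in> Y))"
    using NO_odd_switching[OF assms(2,3,1)] by blast
  show "tg_iso (two_graph_of (NO_odd_V m \<Theta> (\<not> s)) (NO_odd_adj \<Theta>)) (X_tg (4*m) \<Phi>)"
    by (rule tg_iso_X_tg[OF assms(2) p(1), where Y = Y]) (simp add: p(2))
next
  fix \<Theta> :: "'a vec \<Rightarrow> 'a" and \<Psi> :: "'b vec \<Rightarrow> 'b"
  assume \<Theta>: "form_type (4*m) \<Theta> s" and "parabolic m \<Psi>"
  then obtain p Y where p: "bij_betw p {a \<in> vecs (4 * m). \<Theta> a = 1} (NO_odd_V m \<Psi> (\<not> s))"
    "\<forall>x y. x \<in> vecs (4 * m) \<longrightarrow> y \<in> vecs (4 * m) \<longrightarrow> \<Theta> x = 1 \<longrightarrow> \<Theta> y = 1 \<longrightarrow> x \<noteq> y \<longrightarrow>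
      NO_odd_adj \<Psi> (p x) (p y) = (polar \<Theta> x y = 0 \<longleftrightarrow> (x \<in> Y \<longleftrightarrow> y \<in> Y))"
    using NO_odd_switching[OF assms(2,3,1)] by blast
  have qf: "is_qform (4*m) \<Theta>" using \<Theta> by (simp add: form_type_def)
  \<comment> \<open>The vectors with form value 1 label both vertex sets: by \<open>pt\<close> on
    the binary side and by \<open>p\<close> on the quaternary side.\<close>
  show "switching_equiv (NO_even_V (4*m) \<Theta>) (NO_even_adj \<Theta>) (NO_odd_V m \<Psi> (\<not> s)) (NO_odd_adj \<Psi>)"
    using p by (intro switching_equivI[OF bij_pt[OF assms(2) qf] p(1), where Y = Y])
      (simp add: NO_even_adj_iff[OF assms(2) qf])
qed

end
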